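(* Let $n\in\mathbb{N}$. A nonempty set $E\subset\mathbb{R}^n$ is weakly porous if and only if $\operatorname{Mu}(E)>0$.
   Context: $\mathbb{N}=\{1,2,\dots\}$; $|\cdot|$ is $n$-dimensional Lebesgue measure; $\operatorname{dist}(x,E)$ is the Euclidean distance; $B(x,r)$ is the open Euclidean ball. Cubes: a cube is a half-open set $Q=[a_1,b_1)\times\cdots\times[a_n,b_n)$ with all sides of equal length $\ell(Q)=b_i-a_i>0$. For a cube $P$ and $j\ge 0$, $\mathcal{D}_j(P)$ is the collection of the $2^{jn}$ pairwise disjoint half-open cubes of side length $2^{-j}\ell(P)$ whose union is $P$, and $\mathcal{D}(P)=\bigcup_{j\ge0}\mathcal{D}_j(P)$. Weak porosity: let $E\subset\mathbb{R}^n$ be nonempty. A cube $Q\in\mathcal{D}(P)$ is $E$-free if $E\cap Q=\emptyset$. $\mathcal{M}(P)\in\mathcal{D}(P)$ denotes a (fixed choice of a) largest $E$-free dyadic subcube of $P$. $E$ is weakly porous if there are constants $0<c,\delta<1$ such that for every cube $P\subset\mathbb{R}^n$ there exist $N\in\mathbb{N}$ and pairwise disjoint $E$-free cubes $Q_1,\dots,Q_N\in\mathcal{D}(P)$ with $|Q_k|\ge\delta|\mathcal{M}(P)|$ for all $k$ and $\sum_{k=1}^N|Q_k|\ge c|P|$ (in particular, every cube $P$ is required to have an $E$-free dyadic subcube). Muckenhoupt exponent: for a ball $B(x,r)$, $h_E(B(x,r))$ is the supremum of all $t>0$ such that $B(y,t)\subset B(x,r)\setminus E$ for some $y\in B(x,r)$,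 and $h_E(B(x,r))=0$ if there is no such $t$. Let $E_r=\{y\in\mathbb{R}^n:\operatorname{dist}(y,E)<r\}$. If $h_E(B(x,R))>0$ for every $x\in E$ and $R>0$, then $\operatorname{Mu}(E)$ is the supremum of the numbers $\alpha\in\mathbb{R}$ for which there is a constant $C$ such that $$\frac{|E_r\cap B(x,R)|}{|B(x,R)|}\le C\Bigl(\frac{h_E(B(x,R))}{r}\Bigr)^{-\alpha}$$ for every $x\in E$ and $0<r<h_E(B(x,R))\le R$. If $h_E(B(x,R))=0$ for some $x\in E$ and $R>0$, then $\operatorname{Mu}(E)=0$. *)

theory Defs
  imports "HOL-Analysis.Analysis"
begin

definition half_open_cube :: "real ^ 'n \<Rightarrow> real \<Rightarrow> (real ^ 'n) set" where
  "half_open_cube a l = {x. \<forall>i. a $ i \<le> x $ i \<and> x $ i < a $ i + l}"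

definition is_cube :: "(real ^ 'n) set \<Rightarrow> bool" where
  "is_cube Q \<longleftrightarrow> (\<exists>a l. l > 0 \<and> Q = half_open_cube a l)"

text \<open>
  The dyadic subcubes of generation \<open>j\<close> of a cube \<open>P\<close>, listed by the integer position \<open>k\<close> of
  their lower corner in the grid of mesh \<open>l / 2 ^ j\<close>. The corner \<open>a\<close> and the side length \<open>l\<close> are
  determined by \<open>P\<close>. The lemmas \<open>Union_dyadic_gen\<close>, \<open>disjoint_dyadic_gen\<close> and \<open>card_dyadic_gen\<close>
  show that this is the partition of \<open>P\<close> into \<open>2 ^ (j * n)\<close> half-open cubes of side \<open>l / 2 ^ j\<close>.
\<close>

definition dyadic_gen :: "nat \<Rightarrow> (real ^ 'n) set \<Rightarrow> (real ^ 'n) set set" where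
  "dyadic_gen j P =
     {half_open_cube (\<chi> i. a $ i + real (k i) * (l / 2 ^ j)) (l / 2 ^ j) | a l k.
        l > 0 \<and> P = half_open_cube a l \<and> (\<forall>i. k i < (2 ^ j :: nat))}"

definition dyadic :: "(real ^ 'n) set \<Rightarrow> (real ^ 'n) set set" where
  "dyadic P = (\<Union>j. dyadic_gen j P)"

definition free_dyadic :: "(real ^ 'n) set \<Rightarrow> (real ^ 'n) set \<Rightarrow> (real ^ 'n) set set" where
  "free_dyadic E P = {Q \<in> dyadic P. E \<inter> Q = {}}"

text \<open>
  The value is unspecified if \<open>P\<close> has no \<open>E\<close>-free dyadic subcube; the definition of weak porosity
  below forces one to exist, since it asks for \<open>N \<ge> 1\<close> such cubes.
\<close>

definition max_free :: "(real ^ 'n) set \<Rightarrow> (real ^ 'n) set \<Rightarrow> (real ^ 'n) set" where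
  "max_free E P =
     (SOME Q. Q \<in> free_dyadic E P \<and>
        (\<forall>Q' \<in> free_dyadic E P. measure lebesgue Q' \<le> measure lebesgue Q))"

definition weakly_porous :: "(real ^ 'n) set \<Rightarrow> bool" where
  "weakly_porous E \<longleftrightarrow>
     (\<exists>c \<delta> :: real. 0 < c \<and> c < 1 \<and> 0 < \<delta> \<and> \<delta> < 1 \<and>
       (\<forall>P. is_cube P \<longrightarrow>
         (\<exists>(N :: nat) Q. N \<ge> 1 \<and>
            (\<forall>k \<in> {1..N}. Q k \<in> free_dyadic E P) \<and>
            disjoint_family_on Q {1..N} \<and>
            (\<forall>k \<in> {1..N}. measure lebesgue (Q k) \<ge> \<delta> * measure lebesgue (max_free E P)) \<and>
            (\<Sum>k = 1..N. measure lebesgue (Q k)) \<ge> c * measure lebesgue P)))"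

definition hole_radii :: "(real ^ 'n) set \<Rightarrow> (real ^ 'n) set \<Rightarrow> real set" where
  "hole_radii E B = {t. t > 0 \<and> (\<exists>y \<in> B. ball y t \<subseteq> B - E)}"

text \<open>For a ball \<open>B\<close> of radius \<open>r\<close>, the set \<open>hole_radii E B\<close> is bounded above by \<open>r\<close>.\<close>

definition max_hole :: "(real ^ 'n) set \<Rightarrow> (real ^ 'n) set \<Rightarrow> real" where
  "max_hole E B = (if hole_radii E B = {} then 0 else Sup (hole_radii E B))"

definition neighbourhood :: "(real ^ 'n) set \<Rightarrow> real \<Rightarrow> (real ^ 'n) set" where
  "neighbourhood E r = {y. infdist y E < r}"

definition Mu_exponents :: "(real ^ 'n) set \<Rightarrow> real set" where
  "Mu_exponents E =
     {\<alpha>. \<exists>C :: real. \<forall>x \<in> E. \<forall>r R. 0 < r \<and> r < max_hole E (ball x R) \<and> max_hole E (ball x R) \<le> R \<longrightarrow>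
        measure lebesgue (neighbourhood E r \<inter> ball x R) / measure lebesgue (ball x R)
          \<le> C * (max_hole E (ball x R) / r) powr (- \<alpha>)}"

text \<open>
  In the first case, for nonempty \<open>E\<close>, \<open>Mu_exponents E\<close> contains \<open>0\<close> and is bounded above by \<open>n\<close>;
  taking the supremum in the extended reals makes the definition independent of this.
\<close>

definition Mu :: "(real ^ 'n) set \<Rightarrow> ereal" where
  "Mu E = (if \<forall>x \<in> E. \<forall>R > 0. max_hole E (ball x R) > 0
           then Sup (ereal ` Mu_exponents E) else 0)"


lemma half_open_cube_eq_iff:
  fixes a b :: "real ^ 'n"
  assumes "l > 0" "m > 0"
  shows "half_open_cube a l = half_open_cube b m \<longleftrightarrow> a = b \<and> l = m"
proof
  assume eq: "half_open_cube a l = half_open_cube b m"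
  have "a \<in> half_open_cube a l" "b \<in> half_open_cube b m"
    using assms by (auto simp: half_open_cube_def)
  then have "a \<in> half_open_cube b m" "b \<in> half_open_cube a l" using eq by auto
  then have "a $ i = b $ i" for i
    by (simp add: half_open_cube_def order_antisym)
  then have ab: "a = b"
    by (simp add: vec_eq_iff)
  have *: "(\<chi> i. a $ i + t) \<in> half_open_cube a s \<longleftrightarrow> 0 \<le> t \<and> t < s" for s t
    by (auto simp: half_open_cube_def)
  have **: "0 \<le> t \<and> t < l \<longleftrightarrow> 0 \<le> t \<and> t < m" for t
    using *[of t l] *[of t m] eq ab by simp
  have "\<not> m < l" using **[of m] assms by simp
  moreover have "\<not> l < m" using **[of l] assms by simp
  ultimately show "a = b \<and> l = m" using ab by simp
qed simp

lemma dyadic_gen_half_open_cube: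
  assumes "l > 0"
  shows "dyadic_gen j (half_open_cube a l) =
    (\<lambda>k. half_open_cube (\<chi> i. a $ i + real (k i) * (l / 2 ^ j)) (l / 2 ^ j))
      ` {k. \<forall>i. k i < (2 ^ j :: nat)}"
proof -
  have "m > 0 \<and> half_open_cube a l = half_open_cube b m \<and> R \<longleftrightarrow> b = a \<and> m = l \<and> R" for b m R
    using assms half_open_cube_eq_iff[of l m a b] by auto
  then show ?thesis
    by (simp add: dyadic_gen_def set_eq_iff image_iff) (simp add: conj_commute)
qed

lemma mem_subcube_iff:
  fixes a x :: "real ^ 'n"
  assumes "s > 0"
  shows "x \<in> half_open_cube (\<chi> i. a $ i + real (k i) * s) s \<longleftrightarrow>
    (\<forall>i. \<lfloor>(x $ i - a $ i) / s\<rfloor> = int (k i))"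
proof -
  have "\<lfloor>(x $ i - a $ i) / s\<rfloor> = int (k i) \<longleftrightarrow>
      a $ i + real (k i) * s \<le> x $ i \<and> x $ i < a $ i + real (k i) * s + s" for i
    using assms by (simp add: floor_eq_iff pos_le_divide_eq pos_divide_less_eq algebra_simps)
  then show ?thesis by (simp add: half_open_cube_def)
qed

lemma Union_dyadic_gen:
  assumes "is_cube P"
  shows "\<Union> (dyadic_gen j P) = P"
proof -
  obtain a l where l: "l > 0" and P: "P = half_open_cube a l"
    using assms by (auto simp: is_cube_def)
  define s where "s = l / 2 ^ j"
  have s: "s > 0" "l = s * 2 ^ j" using l by (auto simp: s_def)
  have "x \<in> P \<longleftrightarrow> (\<exists>k. (\<forall>i. k i < (2 ^ j :: nat)) \<and> (\<forall>i. \<lfloor>(x $ i - a $ i) / s\<rfloor> = int (k i)))" for x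
  proof -
    have "x \<in> P \<longleftrightarrow> (\<forall>i. 0 \<le> (x $ i - a $ i) / s \<and> (x $ i - a $ i) / s < 2 ^ j)"
    proof -
      have "a $ i \<le> x $ i \<and> x $ i < a $ i + l \<longleftrightarrow>
          0 \<le> (x $ i - a $ i) / s \<and> (x $ i - a $ i) / s < 2 ^ j" for i
        using s by (simp add: pos_le_divide_eq pos_divide_less_eq algebra_simps)
      then show ?thesis by (simp add: P half_open_cube_def)
    qed
    also have "\<dots> \<longleftrightarrow> (\<forall>i. 0 \<le> \<lfloor>(x $ i - a $ i) / s\<rfloor> \<and> \<lfloor>(x $ i - a $ i) / s\<rfloor> < int (2 ^ j))"
      by (simp add: floor_less_iff)
    also have "\<dots> \<longleftrightarrow> (\<forall>i. \<exists>k < (2 ^ j :: nat). \<lfloor>(x $ i - a $ i) / s\<rfloor> = int k)"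
    proof -
      have "0 \<le> z \<and> z < int m \<longleftrightarrow> (\<exists>k < m. z = int k)" for z m
        by (auto intro!: exI[of _ "nat z"])
      then show ?thesis by (simp only:)
    qed
    also have "\<dots> \<longleftrightarrow> (\<exists>k. \<forall>i. k i < (2 ^ j :: nat) \<and> \<lfloor>(x $ i - a $ i) / s\<rfloor> = int (k i))"
      by (rule choice_iff[of "\<lambda>i k. k < (2 ^ j :: nat) \<and> \<lfloor>(x $ i - a $ i) / s\<rfloor> = int k"])
    finally show ?thesis by (simp only: all_conj_distrib)
  qed
  moreover have "\<Union> (dyadic_gen j P) =
      {x. \<exists>k. (\<forall>i. k i < (2 ^ j :: nat)) \<and> (\<forall>i. \<lfloor>(x $ i - a $ i) / s\<rfloor> = int (k i))}"
    unfolding P dyadic_gen_half_open_cube[OF l] s_def[symmetric]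
    by (simp add: set_eq_iff mem_subcube_iff[OF s(1)])
  ultimately show ?thesis by blast
qed

lemma disjoint_dyadic_gen:
  assumes "is_cube P"
  shows "disjoint (dyadic_gen j P)"
proof -
  obtain a l where l: "l > 0" and P: "P = half_open_cube a l"
    using assms by (auto simp: is_cube_def)
  have s: "l / 2 ^ j > 0" using l by auto
  show ?thesis
  proof (rule disjointI)
    fix Q Q' assume "Q \<in> dyadic_gen j P" "Q' \<in> dyadic_gen j P" and ne: "Q \<noteq> Q'"
    then obtain k k' where
      Q: "Q = half_open_cube (\<chi> i. a $ i + real (k i) * (l / 2 ^ j)) (l / 2 ^ j)" and
      Q': "Q' = half_open_cube (\<chi> i. a $ i + real (k' i) * (l / 2 ^ j)) (l / 2 ^ j)"
      unfolding P dyadic_gen_half_open_cube[OF l] by blast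
    have "k = k'" if "x \<in> Q" "x \<in> Q'" for x
      using that unfolding Q Q' mem_subcube_iff[OF s] by (auto simp: fun_eq_iff)
    then show "Q \<inter> Q' = {}" using ne Q Q' by blast
  qed
qed

lemma card_dyadic_gen:
  fixes P :: "(real ^ 'n) set"
  assumes "is_cube P"
  shows "card (dyadic_gen j P) = 2 ^ (j * CARD('n))"
proof -
  obtain a l where l: "l > 0" and P: "P = half_open_cube a l"
    using assms by (auto simp: is_cube_def)
  have s: "l / 2 ^ j > 0" using l by auto
  have inj: "inj_on (\<lambda>k. half_open_cube (\<chi> i. a $ i + real (k i) * (l / 2 ^ j)) (l / 2 ^ j))
      {k. \<forall>i. k i < (2 ^ j :: nat)}"
  proof (rule inj_onI)
    fix k k' :: "'n \<Rightarrow> nat"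
    assume "half_open_cube (\<chi> i. a $ i + real (k i) * (l / 2 ^ j)) (l / 2 ^ j) =
      half_open_cube (\<chi> i. a $ i + real (k' i) * (l / 2 ^ j)) (l / 2 ^ j)"
    then have "(\<chi> i. a $ i + real (k i) * (l / 2 ^ j)) = (\<chi> i. a $ i + real (k' i) * (l / 2 ^ j))"
      using half_open_cube_eq_iff[OF s s] by blast
    then have "real (k i) * (l / 2 ^ j) = real (k' i) * (l / 2 ^ j)" for i
      by (simp only: vec_eq_iff vec_lambda_beta add_left_cancel)
    then show "k = k'"
      using s by (simp only: mult_right_cancel[OF less_imp_neq[OF s, symmetric]] of_nat_eq_iff fun_eq_iff simp_thms)
  qed
  have box: "{k :: 'n \<Rightarrow> nat. \<forall>i. k i < 2 ^ j} = (\<Pi>\<^sub>E i \<in> UNIV. {..<2 ^ j})"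
    by (simp only: PiE_UNIV_domain Pi_def lessThan_iff UNIV_I simp_thms)
  have "card (dyadic_gen j P) = card {k :: 'n \<Rightarrow> nat. \<forall>i. k i < 2 ^ j}"
    using card_image[OF inj] by (simp only: P dyadic_gen_half_open_cube[OF l])
  also have "\<dots> = 2 ^ (j * CARD('n))"
    unfolding box card_PiE[OF finite_class.finite_UNIV]
    by (simp only: card_lessThan prod_constant power_mult)
  finally show ?thesis .
qed

end

theory Submission
  imports Defs
begin

text \<open>
  Both directions go through the property \<open>abundant_holes\<close>: every cube \<open>P\<close> contains disjoint
  \<open>E\<close>-free dyadic subcubes that fill a fixed proportion of \<open>P\<close> and whose sides are at least a
  fixed multiple of the side of every \<open>E\<close>-free cube in \<open>P\<close>, dyadic or not. This is weak
  porosity in terms of side lengths, because an arbitrary cube of side \<open>t\<close> in \<open>P\<close> contains a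
  dyadic subcube of \<open>P\<close> of side at least \<open>t / 4\<close>. Write \<open>E_r\<close> for \<open>neighbourhood E r\<close>.

  From a positive exponent to weak porosity. Let the cube \<open>P\<close> meet \<open>E\<close> in \<open>x\<close>, let \<open>B\<close> be a
  ball around \<open>x\<close> that contains \<open>P\<close> and has comparable size, and let \<open>h\<close> be the maximal hole
  radius of \<open>B\<close>. The defining inequality of a positive exponent makes \<open>E_r\<close> cover at most half
  of \<open>P\<close> when \<open>r = \<eta> * h\<close> and \<open>\<eta>\<close> is a small constant. A point of \<open>P\<close> outside \<open>E_r\<close> has
  distance at least \<open>r\<close> from \<open>E\<close>. Hence in the first dyadic generation of \<open>P\<close> with sides at
  most \<open>r / n\<close>, in dimension \<open>n\<close>, the \<open>E\<close>-free cubes fill the other half. No \<open>E\<close>-free cube in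
  \<open>P\<close> has a side above \<open>2 * h\<close>, hence these cubes are large enough.

  From weak porosity to a positive exponent. The first point is that holes cannot disappear
  suddenly (\<open>hole_small_translation\<close>). If a cube is translated by a small multiple of its
  side, most of its volume stays, so one of the large free cubes that fill a proportion of the
  old cube meets the new cube in a large part, and the new cube has a hole of comparable size.
  Iterated boundedly often, this compares the largest hole of a cube with that of any cube of
  half its side inside it (\<open>hole_parent_to_child\<close>).

  The second point is an iteration. Suppose that \<open>P\<close> has a hole of side \<open>t\<close>. Select the free
  cubes given by \<open>abundant_holes\<close>; each has side at least \<open>\<kappa> * t\<close>, so \<open>E_r\<close> enters it only
  through a shell near its boundary, of relative volume \<open>O(r / t)\<close>. Split the rest of \<open>P\<close> into
  maximal dyadic cubes disjoint from the selected ones. The parent of such a cube contains a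
  selected cube, so the cube itself still has a hole of side \<open>\<mu> * t\<close> with a constant \<open>\<mu>\<close>.
  These remaining cubes have at most the proportion \<open>1 - c\<close> of the volume, and the argument
  repeats in each of them until the holes have size about \<open>r\<close>. This takes about \<open>ln (t / r)\<close>
  rounds, and every round gains a constant factor: the proportion of \<open>P\<close> in \<open>E_r\<close> is at most
  \<open>K * (r / t) powr \<alpha>\<close> for some \<open>\<alpha> > 0\<close> (\<open>neighbourhood_recurrence\<close>,
  \<open>neighbourhood_decay_in_cubes\<close>). Comparing balls with cubes turns this into a positive
  exponent.
\<close>

section \<open>Geometry of half-open cubes\<close>

text \<open>
  A half-open box differs from the closed box only in faces, which are null sets.
\<close>

lemma half_open_box_measure:
  fixes a b :: "real ^ 'n"
  assumes "\<And>i. a $ i \<le> b $ i"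
  shows "{x. \<forall>i. a $ i \<le> x $ i \<and> x $ i < b $ i} \<in> lmeasurable"
    and "measure lebesgue {x. \<forall>i. a $ i \<le> x $ i \<and> x $ i < b $ i} = (\<Prod>i\<in>UNIV. b $ i - a $ i)"
proof -
  let ?H = "{x. \<forall>i. a $ i \<le> x $ i \<and> x $ i < b $ i}"
  have "(cbox a b - ?H) \<union> (?H - cbox a b) \<subseteq> cbox a b - box a b"
    by (auto simp: mem_box_cart) (meson less_imp_le)+
  then have neg: "negligible ((cbox a b - ?H) \<union> (?H - cbox a b))"
    using negligible_frontier_interval negligible_subset by blast
  show "?H \<in> lmeasurable"
    by (rule lmeasurable_negligible_symdiff[OF lmeasurable_cbox neg])
  have "measure lebesgue ?H = measure lebesgue (cbox a b)"
    by (rule measure_negligible_symdiff[OF lmeasurable_cbox neg])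
  moreover have "cbox a b \<noteq> {}"
    using assms by (auto simp: interval_ne_empty_cart)
  ultimately show "measure lebesgue ?H = (\<Prod>i\<in>UNIV. b $ i - a $ i)"
    by (simp add: content_cbox_cart)
qed

lemma cube_measure:
  fixes a :: "real ^ 'n"
  assumes "l \<ge> 0"
  shows "half_open_cube a l \<in> lmeasurable"
    and "measure lebesgue (half_open_cube a l) = l ^ CARD('n)"
proof -
  have eq: "half_open_cube a l = {x. \<forall>i. a $ i \<le> x $ i \<and> x $ i < (\<chi> i. a $ i + l) $ i}"
    by (simp add: half_open_cube_def)
  show "half_open_cube a l \<in> lmeasurable"
    unfolding eq by (rule half_open_box_measure) (use assms in simp)
  show "measure lebesgue (half_open_cube a l) = l ^ CARD('n)"
    unfolding eq by (subst half_open_box_measure) (use assms in simp_all)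
qed

lemma corner_in_cube: "l > 0 \<Longrightarrow> a \<in> half_open_cube a l"
  by (simp add: half_open_cube_def)

lemma cube_subset_iff:
  fixes a b :: "real ^ 'n"
  assumes "s > 0"
  shows "half_open_cube b s \<subseteq> half_open_cube a l \<longleftrightarrow> (\<forall>i. a $ i \<le> b $ i \<and> b $ i + s \<le> a $ i + l)"
proof
  assume sub: "half_open_cube b s \<subseteq> half_open_cube a l"
  have "b \<in> half_open_cube a l" using sub corner_in_cube[OF assms] by blast
  moreover have "b $ i + s \<le> a $ i + l" for i
  proof (rule dense_le_bounded)
    show "b $ i < b $ i + s" using assms by simp
  next
    fix x assume x: "b $ i < x" "x < b $ i + s"
    let ?p = "\<chi> j. b $ j + (x - b $ i)"
    have "?p \<in> half_open_cube b s" using x by (simp add: half_open_cube_def)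
    then have "?p \<in> half_open_cube a l" using sub by blast
    then have "?p $ i < a $ i + l" unfolding half_open_cube_def by blast
    then show "x \<le> a $ i + l" by simp
  qed
  ultimately show "\<forall>i. a $ i \<le> b $ i \<and> b $ i + s \<le> a $ i + l"
    by (simp add: half_open_cube_def)
next
  assume *: "\<forall>i. a $ i \<le> b $ i \<and> b $ i + s \<le> a $ i + l"
  show "half_open_cube b s \<subseteq> half_open_cube a l"
  proof
    fix x assume "x \<in> half_open_cube b s"
    then have x: "b $ i \<le> x $ i" "x $ i < b $ i + s" for i by (auto simp: half_open_cube_def)
    have "a $ i \<le> x $ i \<and> x $ i < a $ i + l" for i
      using x[of i] *[rule_format, of i] by linarith
    then show "x \<in> half_open_cube a l" by (simp add: half_open_cube_def)
  qed
qed

lemma cube_subset_side: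
  assumes "s > 0" "half_open_cube b s \<subseteq> half_open_cube a l"
  shows "s \<le> l"
proof -
  have "a $ i \<le> b $ i \<and> b $ i + s \<le> a $ i + l" for i
    using assms cube_subset_iff by blast
  from this[of undefined] show ?thesis by linarith
qed

lemma cube_mono: "t \<le> u \<Longrightarrow> half_open_cube z t \<subseteq> half_open_cube z u"
  unfolding half_open_cube_def by (auto intro: less_le_trans)

lemma dist_less_if_coords:
  fixes x y :: "real ^ 'n"
  assumes "\<And>i. \<bar>x $ i - y $ i\<bar> < s"
  shows "dist x y < real CARD('n) * s"
proof -
  have "dist x y \<le> (\<Sum>i\<in>UNIV. \<bar>x $ i - y $ i\<bar>)"
    unfolding dist_norm by (rule order_trans[OF norm_le_l1_cart]) simp
  also have "\<dots> < (\<Sum>i\<in>(UNIV::'n set). s)"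
    by (rule sum_strict_mono) (use assms in auto)
  finally show ?thesis by simp
qed

lemma ball_subset_cube: "ball x r \<subseteq> half_open_cube (\<chi> i. x $ i - r) (2 * r)"
proof
  fix y assume "y \<in> ball x r"
  then have *: "norm (x - y) < r" by (simp add: dist_norm)
  have "\<bar>x $ i - y $ i\<bar> < r" for i
    using component_le_norm_cart[of "x - y" i] * by simp
  then have "x $ i - r \<le> y $ i \<and> y $ i < x $ i - r + 2 * r" for i
    by (smt (verit))
  then show "y \<in> half_open_cube (\<chi> i. x $ i - r) (2 * r)"
    by (simp add: half_open_cube_def)
qed

lemma cube_subset_ball:
  fixes x :: "real ^ 'n"
  assumes "r > 0"
  shows "half_open_cube (\<chi> i. x $ i - r / real CARD('n) / 2) (r / real CARD('n)) \<subseteq> ball x r"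
proof
  fix y assume y: "y \<in> half_open_cube (\<chi> i. x $ i - r / real CARD('n) / 2) (r / real CARD('n))"
  define s where "s = r / real CARD('n)"
  have s: "s > 0" using assms by (simp add: s_def)
  have "\<bar>x $ i - y $ i\<bar> < s" for i
  proof -
    have "x $ i - s / 2 \<le> y $ i" "y $ i < x $ i - s / 2 + s"
      using y unfolding half_open_cube_def s_def by auto
    then show ?thesis using s by linarith
  qed
  then show "y \<in> ball x r"
    using dist_less_if_coords[of x y s] by (simp add: s_def)
qed

lemma ball_subset_centred_cube:
  assumes "half_open_cube a s \<subseteq> S"
  shows "ball (\<chi> i. a $ i + s / 2) (s / 2) \<subseteq> S"
  using ball_subset_cube[of "\<chi> i. a $ i + s / 2" "s / 2"] assms by simp

text \<open>
  Bernoulli's inequality: shrinking the side by the factor \<open>1 - v / s\<close> costs at most the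
  proportion \<open>n * (v / s)\<close> of the volume. If \<open>v > s\<close> the bound exceeds the volume of the whole
  cube. The estimate serves twice: for the part of a free cube near its boundary, and for the
  part of a cube that a translation leaves uncovered.
\<close>

lemma shell_measure:
  fixes b z :: "real ^ 'n"
  assumes "0 < s" "0 \<le> v" and sub: "half_open_cube z (s - v) \<subseteq> half_open_cube b s"
  shows "measure lebesgue (half_open_cube b s - half_open_cube z (s - v))
    \<le> real CARD('n) * (v / s) * s ^ CARD('n)"
proof (cases "v \<le> s")
  case True
  have "1 - real CARD('n) * (v / s) \<le> (1 - v / s) ^ CARD('n)"
    using Bernoulli_inequality[of "- (v / s)" "CARD('n)"] True assms(1) by simp
  then have "(1 - real CARD('n) * (v / s)) * s ^ CARD('n) \<le> (1 - v / s) ^ CARD('n) * s ^ CARD('n)"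
    using assms(1) by (intro mult_right_mono) auto
  also have "\<dots> = (s - v) ^ CARD('n)"
    using assms(1) by (simp add: field_simps flip: power_mult_distrib)
  finally have *: "(1 - real CARD('n) * (v / s)) * s ^ CARD('n) \<le> (s - v) ^ CARD('n)" .
  have "measure lebesgue (half_open_cube b s - half_open_cube z (s - v)) = s ^ CARD('n) - (s - v) ^ CARD('n)"
    using measurable_measure_Diff[of "half_open_cube b s" lebesgue "half_open_cube z (s - v)"] assms True
      cube_measure[of s b] cube_measure[of "s - v" z] by (auto dest: fmeasurableD)
  then show ?thesis using * by (simp add: algebra_simps)
next
  case False
  have "half_open_cube z (s - v) = {}"
  proof -
    have "\<not> (z $ i \<le> x $ i \<and> x $ i < z $ i + (s - v))" for x and i :: 'n
      using False by linarith
    then show ?thesis unfolding half_open_cube_def by blast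
  qed
  then have "measure lebesgue (half_open_cube b s - half_open_cube z (s - v)) = s ^ CARD('n)"
    using assms by (simp add: cube_measure(2))
  moreover have "1 \<le> real CARD('n) * (v / s)"
  proof -
    have "1 * 1 \<le> real CARD('n) * (v / s)"
      using False assms by (intro mult_mono) (auto simp: Suc_leI)
    then show ?thesis by simp
  qed
  ultimately show ?thesis
    using assms mult_right_mono[of 1 "real CARD('n) * (v / s)" "s ^ CARD('n)"] by simp
qed

section \<open>Dyadic subcubes\<close>

lemma dyadic_genE:
  assumes "l > 0" "Q \<in> dyadic_gen j (half_open_cube a l)"
  obtains b where "Q = half_open_cube b (l / 2 ^ j)" "Q \<subseteq> half_open_cube a l"
proof -
  have "is_cube (half_open_cube a l)" using assms(1) by (auto simp: is_cube_def)
  then have "Q \<subseteq> half_open_cube a l" using Union_dyadic_gen assms(2) by blast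
  then show ?thesis using assms that by (auto simp: dyadic_gen_half_open_cube)
qed

lemma dyadic_gen_0:
  assumes "l > 0"
  shows "dyadic_gen 0 (half_open_cube a l) = {half_open_cube a l}"
proof -
  have eq: "{k. \<forall>i. k i < (2 ^ 0 :: nat)} = {\<lambda>_. 0}" by auto
  show ?thesis unfolding dyadic_gen_half_open_cube[OF assms] eq by simp
qed

lemma dyadic_gen_Suc:
  assumes "l > 0" "Q \<in> dyadic_gen (Suc j) (half_open_cube a l)"
  shows "\<exists>R \<in> dyadic_gen 1 (half_open_cube a l). Q \<in> dyadic_gen j R"
proof -
  obtain k where k: "\<And>i. k i < (2 ^ Suc j :: nat)"
    and Q: "Q = half_open_cube (\<chi> i. a $ i + real (k i) * (l / 2 ^ Suc j)) (l / 2 ^ Suc j)"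
    using assms by (auto simp: dyadic_gen_half_open_cube)
  define b where "b = (\<chi> i. a $ i + real (k i div 2 ^ j) * (l / 2 ^ 1))"
  have "k i div 2 ^ j < 2 ^ 1" for i
    using k[of i] by (simp add: div_less_iff_less_mult mult.commute)
  then have R: "half_open_cube b (l / 2 ^ 1) \<in> dyadic_gen 1 (half_open_cube a l)"
    unfolding dyadic_gen_half_open_cube[OF assms(1)] b_def
    by (intro image_eqI[where x = "\<lambda>i. k i div 2 ^ j"]) auto
  have "a $ i + real (k i) * (l / 2 ^ Suc j) = b $ i + real (k i mod 2 ^ j) * (l / 2 ^ 1 / 2 ^ j)" for i
  proof -
    have "k i = k i div 2 ^ j * 2 ^ j + k i mod 2 ^ j"
      by (rule div_mult_mod_eq[symmetric])
    then have eq: "real (k i) = real (k i div 2 ^ j) * 2 ^ j + real (k i mod 2 ^ j)"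
      by (metis of_nat_add of_nat_mult of_nat_numeral of_nat_power)
    show ?thesis unfolding eq b_def by (simp add: field_simps)
  qed
  then have "Q \<in> dyadic_gen j (half_open_cube b (l / 2 ^ 1))"
    unfolding Q by (subst dyadic_gen_half_open_cube)
      (use assms in \<open>auto intro!: image_eqI[where x = "\<lambda>i. k i mod 2 ^ j"]\<close>)
  with R show ?thesis by blast
qed

lemma finite_dyadic_gen:
  assumes "l > 0" shows "finite (dyadic_gen j (half_open_cube a l))"
proof -
  have "is_cube (half_open_cube a l)" using assms by (auto simp: is_cube_def)
  from card_dyadic_gen[OF this, of j] show ?thesis by (intro card_ge_0_finite) simp
qed

text \<open>
  Take the first dyadic mesh of at most half the side \<open>t\<close>: rounding the corner of the small
  cube up to the grid then stays inside it, and the previous mesh being too coarse gives the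
  bound \<open>t / 4\<close>.
\<close>

lemma cube_contains_dyadic:
  fixes a z :: "real ^ 'n"
  assumes "l > 0" "t > 0" and sub: "half_open_cube z t \<subseteq> half_open_cube a l"
  shows "\<exists>j b. half_open_cube b (l / 2 ^ j) \<in> dyadic_gen j (half_open_cube a l)
    \<and> half_open_cube b (l / 2 ^ j) \<subseteq> half_open_cube z t \<and> t / 4 \<le> l / 2 ^ j"
proof -
  have za: "a $ i \<le> z $ i \<and> z $ i + t \<le> a $ i + l" for i
    using sub cube_subset_iff[OF assms(2)] by blast
  define j where "j = (LEAST j. 2 * (l / 2 ^ j) \<le> t)"
  have ex: "\<exists>j. 2 * (l / 2 ^ j) \<le> t"
  proof -
    obtain j :: nat where "2 * l / t < 2 ^ j"
      using real_arch_pow[of 2 "2 * l / t"] by auto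
    then show ?thesis using assms by (intro exI[of _ j]) (simp add: field_simps)
  qed
  have j: "2 * (l / 2 ^ j) \<le> t" unfolding j_def using ex by (rule LeastI_ex)
  have "j \<noteq> 0"
  proof
    assume "j = 0"
    then have "2 * l \<le> t" using j by simp
    then show False using za[of undefined] assms by linarith
  qed
  then obtain i where i: "j = Suc i" using not0_implies_Suc by blast
  have "\<not> 2 * (l / 2 ^ i) \<le> t" using not_less_Least[of i "\<lambda>j. 2 * (l / 2 ^ j) \<le> t"] i unfolding j_def by simp
  then have side: "t / 4 \<le> l / 2 ^ j" using i by (simp add: field_simps)
  define s where "s = l / 2 ^ j"
  have s: "s > 0" "2 * s \<le> t" "l = s * 2 ^ j" using assms j by (auto simp: s_def)
  define k where "k i = nat \<lceil>(z $ i - a $ i) / s\<rceil>" for i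
  have k: "(z $ i - a $ i) / s \<le> real (k i)" "real (k i) < (z $ i - a $ i) / s + 1" for i
  proof -
    have "0 \<le> (z $ i - a $ i) / s" using za[of i] s by simp
    then show "(z $ i - a $ i) / s \<le> real (k i)" "real (k i) < (z $ i - a $ i) / s + 1"
      unfolding k_def by linarith+
  qed
  have k': "z $ i - a $ i \<le> real (k i) * s" "real (k i) * s < z $ i - a $ i + s" for i
    using k[of i] s(1) by (simp_all add: field_simps)
  have "k i < 2 ^ j" for i
  proof -
    have "real (k i) * s < s * 2 ^ j" using k'[of i] za[of i] s by linarith
    then have "real (k i) * s < 2 ^ j * s" by (simp add: mult.commute)
    then have "real (k i) < real (2 ^ j)" using s(1) by simp
    then show ?thesis by (simp only: of_nat_less_iff)
  qed
  then have "half_open_cube (\<chi> i. a $ i + real (k i) * s) s \<in> dyadic_gen j (half_open_cube a l)"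
    unfolding dyadic_gen_half_open_cube[OF assms(1)] s_def by blast
  moreover have "half_open_cube (\<chi> i. a $ i + real (k i) * s) s \<subseteq> half_open_cube z t"
    unfolding cube_subset_iff[OF s(1)]
  proof (intro allI conjI)
    fix i
    show "z $ i \<le> (\<chi> i. a $ i + real (k i) * s) $ i"
      "(\<chi> i. a $ i + real (k i) * s) $ i + s \<le> z $ i + t"
      using k'[of i] s by simp_all
  qed
  ultimately show ?thesis using side unfolding s_def by blast
qed

text \<open>
  The maximum is attained because the volume of a dyadic subcube decreases with its
  generation, and generations are well-ordered.
\<close>

lemma max_free_greatest:
  fixes a :: "real ^ 'n"
  assumes l: "l > 0" and Q: "Q \<in> free_dyadic E (half_open_cube a l)"
  shows "max_free E (half_open_cube a l) \<in> free_dyadic E (half_open_cube a l)"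
    and "measure lebesgue Q \<le> measure lebesgue (max_free E (half_open_cube a l))"
proof -
  let ?P = "half_open_cube a l"
  define G where "G j \<longleftrightarrow> (\<exists>Q \<in> dyadic_gen j ?P. E \<inter> Q = {})" for j
  have free_G: "\<exists>j. R \<in> dyadic_gen j ?P \<and> G j" if "R \<in> free_dyadic E ?P" for R
    using that unfolding free_dyadic_def dyadic_def G_def by blast
  have meas: "measure lebesgue R = (l / 2 ^ j) ^ CARD('n)" if "R \<in> dyadic_gen j ?P" for R j
    using that l by (elim dyadic_genE[OF l]) (simp add: cube_measure(2))
  have "\<exists>j. G j" using free_G Q by blast
  then have "G (Least G)" by (rule LeastI_ex)
  then obtain M where M: "M \<in> dyadic_gen (Least G) ?P" "E \<inter> M = {}" unfolding G_def by blast
  have "measure lebesgue R \<le> measure lebesgue M" if R: "R \<in> free_dyadic E ?P" for R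
  proof -
    obtain j where j: "R \<in> dyadic_gen j ?P" "G j" using free_G[OF R] by blast
    have "Least G \<le> j" using j(2) by (rule Least_le)
    then have "l / 2 ^ j \<le> l / 2 ^ Least G"
      using l by (intro divide_left_mono power_increasing) auto
    then show ?thesis
      unfolding meas[OF j(1)] meas[OF M(1)] using l by (intro power_mono) auto
  qed
  moreover have "M \<in> free_dyadic E ?P" using M unfolding free_dyadic_def dyadic_def by blast
  ultimately have "\<exists>Q. Q \<in> free_dyadic E ?P \<and>
      (\<forall>Q' \<in> free_dyadic E ?P. measure lebesgue Q' \<le> measure lebesgue Q)" by blast
  from someI_ex[OF this] Q
  show "max_free E ?P \<in> free_dyadic E ?P"
    "measure lebesgue Q \<le> measure lebesgue (max_free E ?P)"
    unfolding max_free_def[symmetric] by blast+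
qed

section \<open>A reformulation of weak porosity\<close>

text \<open>
  Weak porosity with side lengths instead of volumes. Lower bounds refer to every \<open>E\<close>-free
  cube in the cube and not just to dyadic ones, so that holes of cubes from different dyadic
  grids can be compared.
\<close>

definition abundant_holes :: "real \<Rightarrow> real \<Rightarrow> (real ^ 'n) set \<Rightarrow> bool" where
  "abundant_holes c \<kappa> E \<longleftrightarrow>
     (\<forall>a l. l > 0 \<longrightarrow> (\<exists>F. finite F \<and> disjoint F \<and> F \<subseteq> free_dyadic E (half_open_cube a l) \<and>
        (\<forall>Q \<in> F. \<exists>b u. Q = half_open_cube b u \<and> u > 0 \<and>
           (\<forall>z t. t > 0 \<longrightarrow> half_open_cube z t \<subseteq> half_open_cube a l - E \<longrightarrow> \<kappa> * t \<le> u)) \<and>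
        c * l ^ CARD('n) \<le> (\<Sum>Q\<in>F. measure lebesgue Q)))"

lemma abundant_holesE:
  fixes a :: "real ^ 'n"
  assumes "abundant_holes c \<kappa> E" "l > 0"
  obtains F where "finite F" "disjoint F" "F \<subseteq> free_dyadic E (half_open_cube a l)"
    "\<And>Q. Q \<in> F \<Longrightarrow> \<exists>b u. Q = half_open_cube b u \<and> u > 0 \<and>
       (\<forall>z t. t > 0 \<longrightarrow> half_open_cube z t \<subseteq> half_open_cube a l - E \<longrightarrow> \<kappa> * t \<le> u)"
    "c * l ^ CARD('n) \<le> (\<Sum>Q\<in>F. measure lebesgue Q)"
proof -
  note ex = assms(1)[unfolded abundant_holes_def, THEN spec, THEN spec, THEN mp, OF assms(2)]
  show ?thesis
    by (rule exE[OF ex[of a]], elim conjE, rule that) (assumption | drule bspec)+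
qed

lemma free_dyadicE:
  assumes "l > 0" "Q \<in> free_dyadic E (half_open_cube a l)"
  obtains b u where "Q = half_open_cube b u" "u > 0" "u \<le> l" "Q \<subseteq> half_open_cube a l - E"
proof -
  obtain j where j: "Q \<in> dyadic_gen j (half_open_cube a l)" "E \<inter> Q = {}"
    using assms(2) unfolding free_dyadic_def dyadic_def by blast
  obtain b where "Q = half_open_cube b (l / 2 ^ j)" "Q \<subseteq> half_open_cube a l"
    using dyadic_genE[OF assms(1) j(1)] .
  moreover have "l / 2 ^ j \<le> l" using assms(1) by (simp add: field_simps)
  ultimately show ?thesis using that[of b "l / 2 ^ j"] j(2) assms(1) by auto
qed

lemma free_dyadic_subset:
  assumes "l > 0" "Q \<in> free_dyadic E (half_open_cube a l)"
  shows "Q \<subseteq> half_open_cube a l - E"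
proof -
  obtain b u where "Q \<subseteq> half_open_cube a l - E" by (rule free_dyadicE[OF assms])
  then show ?thesis .
qed

text \<open>
  Passing from volumes to sides keeps the constant \<open>d\<close>, since \<open>d ^ n \<le> d\<close>; the factor \<open>1 / 4\<close>
  is the price for replacing an arbitrary free cube by a dyadic one.
\<close>

lemma weakly_porous_imp_abundant_holes:
  fixes E :: "(real ^ 'n) set"
  assumes "weakly_porous E"
  obtains c \<kappa> where "0 < c" "c < 1" "0 < \<kappa>" "\<kappa> < 1" "abundant_holes c \<kappa> E"
proof -
  obtain c d where cd: "0 < c" "c < 1" "0 < d" "d < (1::real)"
    and wp: "\<And>P :: (real ^ 'n) set. is_cube P \<Longrightarrow> \<exists>(N :: nat) Q. N \<ge> 1 \<and>
            (\<forall>k \<in> {1..N}. Q k \<in> free_dyadic E P) \<and>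
            disjoint_family_on Q {1..N} \<and>
            (\<forall>k \<in> {1..N}. measure lebesgue (Q k) \<ge> d * measure lebesgue (max_free E P)) \<and>
            (\<Sum>k = 1..N. measure lebesgue (Q k)) \<ge> c * measure lebesgue P"
    using assms unfolding weakly_porous_def by blast
  have "abundant_holes c (d / 4) E"
    unfolding abundant_holes_def
  proof (intro allI impI)
    fix a :: "real ^ 'n" and l :: real assume l: "l > 0"
    let ?P = "half_open_cube a l"
    have "is_cube ?P" using l by (auto simp: is_cube_def)
    from wp[OF this] obtain N Q where N: "N \<ge> (1::nat)"
      and free: "\<And>k. k \<in> {1..N} \<Longrightarrow> Q k \<in> free_dyadic E ?P"
      and disj: "disjoint_family_on Q {1..N}"
      and big: "\<And>k. k \<in> {1..N} \<Longrightarrow> measure lebesgue (Q k) \<ge> d * measure lebesgue (max_free E ?P)"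
      and tot: "(\<Sum>k = 1..N. measure lebesgue (Q k)) \<ge> c * measure lebesgue ?P"
      by blast
    have ne: "Q k \<noteq> {}" if "k \<in> {1..N}" for k
      using free_dyadicE[OF l free[OF that]] corner_in_cube by (metis empty_iff)
    have inj: "inj_on Q {1..N}"
      using disj ne unfolding inj_on_def disjoint_family_on_def by (metis Int_absorb)
    have "disjoint (Q ` {1..N})"
      using disj by (rule disjoint_family_on_disjoint_image)
    moreover have "c * l ^ CARD('n) \<le> (\<Sum>R\<in>Q ` {1..N}. measure lebesgue R)"
      unfolding sum.reindex[OF inj] o_def using tot l by (simp add: cube_measure(2))
    moreover have "\<exists>b u. R = half_open_cube b u \<and> u > 0 \<and>
        (\<forall>z t. t > 0 \<longrightarrow> half_open_cube z t \<subseteq> ?P - E \<longrightarrow> d / 4 * t \<le> u)"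
      if R: "R \<in> Q ` {1..N}" for R
    proof -
      obtain k where k: "k \<in> {1..N}" "R = Q k" using R by blast
      obtain b u where u: "R = half_open_cube b u" "u > 0"
        using free_dyadicE[OF l free[OF k(1)]] k(2) by metis
      have "d / 4 * t \<le> u" if t: "t > 0" and z: "half_open_cube z t \<subseteq> ?P - E" for z t
      proof -
        from z have zP: "half_open_cube z t \<subseteq> ?P" by blast
        obtain j b' where b': "half_open_cube b' (l / 2 ^ j) \<in> dyadic_gen j ?P"
            "half_open_cube b' (l / 2 ^ j) \<subseteq> half_open_cube z t" and v: "t / 4 \<le> l / 2 ^ j"
          using cube_contains_dyadic[OF l t zP] by blast
        define v where "v = l / 2 ^ j"
        have "v > 0" using l by (simp add: v_def)
        have "half_open_cube b' v \<in> free_dyadic E ?P"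
          using b' z unfolding free_dyadic_def dyadic_def v_def by blast
        from max_free_greatest(2)[OF l this]
        have "v ^ CARD('n) \<le> measure lebesgue (max_free E ?P)"
          using \<open>v > 0\<close> by (simp add: cube_measure(2))
        then have "d * v ^ CARD('n) \<le> d * measure lebesgue (max_free E ?P)"
          using cd by simp
        also have "\<dots> \<le> u ^ CARD('n)"
          using big[OF k(1)] u by (simp add: cube_measure(2) flip: k(2))
        finally have vu: "d * v ^ CARD('n) \<le> u ^ CARD('n)" .
        \<comment> \<open>Otherwise \<open>u ^ n < (d * v) ^ n \<le> d * v ^ n\<close>.\<close>
        have "d * v \<le> u"
        proof (rule ccontr)
          assume "\<not> d * v \<le> u"
          then have "u ^ CARD('n) < (d * v) ^ CARD('n)"
            using u(2) by (intro power_strict_mono) auto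
          also have "\<dots> = d ^ CARD('n) * v ^ CARD('n)" by (rule power_mult_distrib)
          also have "\<dots> \<le> d * v ^ CARD('n)"
            using cd \<open>v > 0\<close> power_decreasing[of 1 "CARD('n)" d]
            by (intro mult_right_mono) (auto simp: Suc_leI)
          finally show False using vu by simp
        qed
        moreover have "d * (t / 4) \<le> d * v" using v cd unfolding v_def by (intro mult_left_mono) auto
        ultimately show ?thesis by simp
      qed
      then show ?thesis using u by blast
    qed
    ultimately show "\<exists>F. finite F \<and> disjoint F \<and> F \<subseteq> free_dyadic E ?P \<and>
        (\<forall>Q \<in> F. \<exists>b u. Q = half_open_cube b u \<and> u > 0 \<and>
           (\<forall>z t. t > 0 \<longrightarrow> half_open_cube z t \<subseteq> ?P - E \<longrightarrow> d / 4 * t \<le> u)) \<and>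
        c * l ^ CARD('n) \<le> (\<Sum>Q\<in>F. measure lebesgue Q)"
      using free by (intro exI[of _ "Q ` {1..N}"]) blast
  qed
  then show ?thesis using that[of c "d / 4"] cd by simp
qed

lemma abundant_holes_imp_weakly_porous:
  fixes E :: "(real ^ 'n) set"
  assumes c: "0 < c" "c < 1" and \<kappa>: "0 < \<kappa>" "\<kappa> < 1" and holes: "abundant_holes c \<kappa> E"
  shows "weakly_porous E"
proof -
  let ?\<delta> = "\<kappa> ^ CARD('n)"
  have "\<exists>(N :: nat) Q. N \<ge> 1 \<and> (\<forall>k \<in> {1..N}. Q k \<in> free_dyadic E P) \<and>
      disjoint_family_on Q {1..N} \<and>
      (\<forall>k \<in> {1..N}. measure lebesgue (Q k) \<ge> ?\<delta> * measure lebesgue (max_free E P)) \<and>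
      (\<Sum>k = 1..N. measure lebesgue (Q k)) \<ge> c * measure lebesgue P"
    if cube: "is_cube P" for P :: "(real ^ 'n) set"
  proof -
    obtain a l where l: "l > 0" and P: "P = half_open_cube a l"
      using cube unfolding is_cube_def by blast
    obtain F where F: "finite F" "disjoint F" "F \<subseteq> free_dyadic E P"
      and side: "\<And>Q. Q \<in> F \<Longrightarrow> \<exists>b u. Q = half_open_cube b u \<and> u > 0 \<and>
           (\<forall>z t. t > 0 \<longrightarrow> half_open_cube z t \<subseteq> P - E \<longrightarrow> \<kappa> * t \<le> u)"
      and tot: "c * l ^ CARD('n) \<le> (\<Sum>Q\<in>F. measure lebesgue Q)"
      unfolding P by (fact abundant_holesE[OF holes l, of a])
    have "0 < c * l ^ CARD('n)" using c l by simp
    then have "F \<noteq> {}" using tot by auto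
    then have card: "card F \<ge> 1" using F(1) by (simp add: Suc_leI card_gt_0_iff)
    obtain Q where Q: "bij_betw Q {1..card F} F"
      using ex_bij_betw_nat_finite_1[OF F(1)] by blast
    have QF: "Q k \<in> F" if "k \<in> {1..card F}" for k using bij_betwE[OF Q] that by blast
    have disj: "disjoint_family_on Q {1..card F}"
      unfolding disjoint_family_on_def
    proof (intro ballI impI)
      fix i j assume ij: "i \<in> {1..card F}" "j \<in> {1..card F}" "i \<noteq> j"
      have "Q i \<noteq> Q j" using ij inj_onD[OF bij_betw_imp_inj_on[OF Q], of i j] by blast
      then show "Q i \<inter> Q j = {}" by (rule disjointD[OF F(2) QF[OF ij(1)] QF[OF ij(2)]])
    qed
    have big: "measure lebesgue (Q k) \<ge> ?\<delta> * measure lebesgue (max_free E P)"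
      if k: "k \<in> {1..card F}" for k
    proof -
      have "Q k \<in> free_dyadic E (half_open_cube a l)" using QF[OF k] F(3) P by blast
      from max_free_greatest(1)[OF l this]
      have "max_free E P \<in> free_dyadic E (half_open_cube a l)" unfolding P .
      then obtain b v where v: "max_free E P = half_open_cube b v" "v > 0"
        "half_open_cube b v \<subseteq> P - E"
        using free_dyadicE[OF l, of "max_free E P" E a] unfolding P[symmetric] by metis
      obtain b' u where u: "Q k = half_open_cube b' u" "u > 0" "\<kappa> * v \<le> u"
        using side[OF QF[OF k]] v by blast
      have "(\<kappa> * v) ^ CARD('n) \<le> u ^ CARD('n)" using u v \<kappa> by (intro power_mono) auto
      then show ?thesis using u v by (simp add: cube_measure(2) power_mult_distrib)
    qed
    have "(\<Sum>k = 1..card F. measure lebesgue (Q k)) = (\<Sum>R\<in>F. measure lebesgue R)"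
      by (rule sum.reindex_bij_betw[OF Q])
    then have sum: "(\<Sum>k = 1..card F. measure lebesgue (Q k)) \<ge> c * measure lebesgue P"
      using tot l by (simp add: P cube_measure(2))
    show ?thesis
      using card disj big sum QF F(3) by (intro exI[of _ "card F"] exI[of _ Q] conjI ballI) auto
  qed
  moreover have "0 < ?\<delta>" "?\<delta> < 1" using \<kappa> by (simp_all add: power_less_one_iff)
  ultimately show ?thesis using c unfolding weakly_porous_def by blast
qed

section \<open>Holes in balls\<close>

lemma hole_radii_ball:
  "t \<in> hole_radii E (ball x R) \<longleftrightarrow> t > 0 \<and> (\<exists>y. ball y t \<subseteq> ball x R - E)"
proof -
  have "y \<in> ball x R" if "t > 0" "ball y t \<subseteq> ball x R - E" for y
    using that centre_in_ball[of y t] by blast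
  then show ?thesis unfolding hole_radii_def by blast
qed

lemma hole_radius_le:
  fixes x :: "real ^ 'n"
  assumes "t \<in> hole_radii E (ball x R)"
  shows "t \<le> R"
proof -
  obtain y where "t > 0" "ball y t \<subseteq> ball x R"
    using assms unfolding hole_radii_ball by blast
  then have "dist y x + t \<le> R" by (simp add: ball_subset_ball_iff)
  then show ?thesis using zero_le_dist[of y x] by linarith
qed

lemma bdd_above_hole_radii: "bdd_above (hole_radii E (ball (x :: real ^ 'n) R))"
  using hole_radius_le by (intro bdd_aboveI[of _ R]) blast

lemma le_max_hole:
  fixes x :: "real ^ 'n"
  assumes "t > 0" "ball y t \<subseteq> ball x R - E"
  shows "t \<le> max_hole E (ball x R)"
proof -
  have "t \<in> hole_radii E (ball x R)" using assms hole_radii_ball by blast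
  then show ?thesis
    unfolding max_hole_def using cSup_upper[OF _ bdd_above_hole_radii] by auto
qed

lemma max_hole_le:
  fixes x :: "real ^ 'n"
  assumes "R \<ge> 0"
  shows "max_hole E (ball x R) \<le> R"
  unfolding max_hole_def using assms hole_radius_le by (auto intro!: cSup_least)

lemma less_max_holeE:
  fixes x :: "real ^ 'n"
  assumes "0 \<le> r" "r < max_hole E (ball x R)"
  obtains y t where "r < t" "ball y t \<subseteq> ball x R - E"
proof -
  have ne: "hole_radii E (ball x R) \<noteq> {}" using assms unfolding max_hole_def by auto
  then have "r < Sup (hole_radii E (ball x R))" using assms unfolding max_hole_def by simp
  then obtain t where "t \<in> hole_radii E (ball x R)" "r < t"
    using less_cSup_iff[OF ne bdd_above_hole_radii] by blast
  then show ?thesis using that hole_radii_ball by blast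
qed

lemma neighbourhood_measurable [measurable]: "neighbourhood E r \<in> sets lebesgue"
proof -
  have "open (neighbourhood E r)"
    unfolding neighbourhood_def by (intro open_Collect_less continuous_intros)
  then show ?thesis by (simp add: borel_open)
qed

section \<open>A positive Muckenhoupt exponent gives weak porosity\<close>

text \<open>
  A dyadic cube of diameter less than \<open>r\<close> that contains a point at distance at least \<open>r\<close> from
  \<open>E\<close> cannot meet \<open>E\<close>.
\<close>

lemma dyadic_cubes_outside_neighbourhood:
  fixes a :: "real ^ 'n"
  assumes E: "E \<noteq> {}" and l: "l > 0" and small: "real CARD('n) * (l / 2 ^ j) \<le> r"
  shows "half_open_cube a l - neighbourhood E r \<subseteq> \<Union> {Q \<in> dyadic_gen j (half_open_cube a l). E \<inter> Q = {}}"
proof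
  fix y assume y: "y \<in> half_open_cube a l - neighbourhood E r"
  have "is_cube (half_open_cube a l)" using l by (auto simp: is_cube_def)
  from Union_dyadic_gen[OF this, of j] y
  obtain Q where Q: "Q \<in> dyadic_gen j (half_open_cube a l)" "y \<in> Q" by blast
  obtain b where b: "Q = half_open_cube b (l / 2 ^ j)" using dyadic_genE[OF l Q(1)] .
  have "E \<inter> Q = {}"
  proof (rule ccontr)
    assume "E \<inter> Q \<noteq> {}"
    then obtain e where e: "e \<in> E" "e \<in> Q" by blast
    have "\<bar>y $ i - e $ i\<bar> < l / 2 ^ j" for i
    proof -
      have "b $ i \<le> y $ i" "y $ i < b $ i + l / 2 ^ j" "b $ i \<le> e $ i" "e $ i < b $ i + l / 2 ^ j"
        using Q(2) e(2) unfolding b half_open_cube_def by blast+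
      then show ?thesis by (simp add: abs_less_iff)
    qed
    then have "dist y e < r" using dist_less_if_coords[of y e "l / 2 ^ j"] small by simp
    then have "infdist y E < r" using infdist_le[OF e(1), of y] by simp
    then show False using y by (simp add: neighbourhood_def)
  qed
  then show "y \<in> \<Union> {Q \<in> dyadic_gen j (half_open_cube a l). E \<inter> Q = {}}" using Q by blast
qed

lemma dyadic_scale:
  fixes l s :: real
  assumes "l > 0" "s > 0"
  shows "\<exists>j. l / 2 ^ j \<le> s \<and> min l (s / 2) \<le> l / 2 ^ j"
proof -
  define j where "j = (LEAST j. l / 2 ^ j \<le> s)"
  obtain m :: nat where "l / s < 2 ^ m" using real_arch_pow[of 2 "l / s"] by auto
  then have "\<exists>j. l / 2 ^ j \<le> s" using assms by (intro exI[of _ m]) (simp add: field_simps)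
  then have j: "l / 2 ^ j \<le> s" unfolding j_def by (rule LeastI_ex)
  have "min l (s / 2) \<le> l / 2 ^ j"
  proof (cases j)
    case (Suc i)
    then have "\<not> l / 2 ^ i \<le> s" using not_less_Least[of i "\<lambda>j. l / 2 ^ j \<le> s"] unfolding j_def by simp
    then have "s / 2 \<le> l / 2 ^ j" using Suc by (simp add: field_simps)
    then show ?thesis by (rule min.coboundedI2)
  qed simp
  with j show ?thesis by blast
qed

text \<open>
  The positive exponent enters only here. The quotient of volumes of the ball and the cube is
  bounded by a dimensional constant \<open>G\<close>, so the estimate for \<open>r = \<eta> * h\<close> reads
  \<open>C * G * \<eta> powr \<alpha>\<close>, which is small for small \<open>\<eta>\<close>. The hypothesis that all holes have
  positive size makes \<open>r = \<eta> * h\<close> an admissible radius.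
\<close>

lemma Mu_exponent_imp_sparse_neighbourhood:
  fixes E :: "(real ^ 'n) set"
  assumes \<alpha>: "\<alpha> \<in> Mu_exponents E" "\<alpha> > 0"
    and pos: "\<And>x R. x \<in> E \<Longrightarrow> R > 0 \<Longrightarrow> max_hole E (ball x R) > 0"
  obtains \<eta> where "0 < \<eta>" "\<eta> < 1"
    "\<And>x a l. \<lbrakk>l > 0; x \<in> E \<inter> half_open_cube a l\<rbrakk> \<Longrightarrow>
       half_open_cube a l \<subseteq> ball x ((real CARD('n) + 1) * l) \<and>
       measure lebesgue (neighbourhood E (\<eta> * max_hole E (ball x ((real CARD('n) + 1) * l))) \<inter> half_open_cube a l)
         \<le> l ^ CARD('n) / 2"
proof -
  obtain C where C: "\<And>x r R. \<lbrakk>x \<in> E; 0 < r; r < max_hole E (ball x R); max_hole E (ball x R) \<le> R\<rbrakk> \<Longrightarrow>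
      measure lebesgue (neighbourhood E r \<inter> ball x R) / measure lebesgue (ball x R)
        \<le> C * (max_hole E (ball x R) / r) powr (- \<alpha>)"
    using \<alpha>(1) unfolding Mu_exponents_def by blast
  define G where "G = (2 * (real CARD('n) + 1)) ^ CARD('n)"
  have G: "G > 0" unfolding G_def by (intro zero_less_power) auto
  \<comment> \<open>The constant \<open>C\<close> may be zero or negative, hence \<open>\<bar>C\<bar> + 1\<close>.\<close>
  define w where "w = 1 / (2 * (\<bar>C\<bar> + 1) * G)"
  have w: "w > 0" using G by (simp add: w_def)
  define \<eta> where "\<eta> = min (1 / 2) (w powr (1 / \<alpha>))"
  have \<eta>: "0 < \<eta>" "\<eta> < 1" using w by (auto simp: \<eta>_def)
  have "\<eta> powr \<alpha> \<le> (w powr (1 / \<alpha>)) powr \<alpha>"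
    using \<eta> \<alpha>(2) by (intro powr_mono2) (auto simp: \<eta>_def)
  also have "\<dots> = w" using \<alpha>(2) w by (simp add: powr_powr)
  finally have \<eta>w: "\<eta> powr \<alpha> \<le> w" .
  have "w * G = 1 / (2 * (\<bar>C\<bar> + 1))" using G by (simp add: w_def)
  then have "\<bar>C\<bar> * w * G = \<bar>C\<bar> / (2 * (\<bar>C\<bar> + 1))" by (simp add: mult.assoc)
  also have "\<dots> \<le> 1 / 2" by (simp add: field_simps)
  finally have CwG: "\<bar>C\<bar> * w * G \<le> 1 / 2" .
  have "half_open_cube a l \<subseteq> ball x ((real CARD('n) + 1) * l) \<and>
       measure lebesgue (neighbourhood E (\<eta> * max_hole E (ball x ((real CARD('n) + 1) * l))) \<inter> half_open_cube a l)
         \<le> l ^ CARD('n) / 2"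
    if l: "l > 0" and x: "x \<in> E \<inter> half_open_cube a l" for x a l
  proof
    define R where "R = (real CARD('n) + 1) * l"
    have R: "R > 0" using l by (simp add: R_def)
    let ?h = "max_hole E (ball x R)"
    have h: "?h > 0" "?h \<le> R" using pos[of x R] x R max_hole_le[of R E x] by auto
    show sub: "half_open_cube a l \<subseteq> ball x ((real CARD('n) + 1) * l)"
    proof
      fix y assume y: "y \<in> half_open_cube a l"
      have "\<bar>x $ i - y $ i\<bar> < l" for i
      proof -
        have "a $ i \<le> y $ i" "y $ i < a $ i + l" "a $ i \<le> x $ i" "x $ i < a $ i + l"
          using x y unfolding half_open_cube_def by blast+
        then show ?thesis by (simp add: abs_less_iff)
      qed
      then have "dist x y < real CARD('n) * l" by (rule dist_less_if_coords)
      then show "y \<in> ball x ((real CARD('n) + 1) * l)" using l by (simp add: algebra_simps)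
    qed
    let ?N = "neighbourhood E (\<eta> * ?h)"
    have "measure lebesgue (?N \<inter> half_open_cube a l) \<le> measure lebesgue (?N \<inter> ball x R)"
      using sub cube_measure(1)[of l a] l unfolding R_def
      by (intro measure_mono_fmeasurable) (auto intro: fmeasurable_Int_fmeasurable simp: Int_commute)
    also have "\<dots> = measure lebesgue (?N \<inter> ball x R) / measure lebesgue (ball x R) * measure lebesgue (ball x R)"
      using content_ball_pos[OF R, of x] by simp
    also have "\<dots> \<le> (C * (?h / (\<eta> * ?h)) powr (- \<alpha>)) * measure lebesgue (ball x R)"
      using C[of x "\<eta> * ?h" R] x \<eta> h by (intro mult_right_mono) auto
    also have "(?h / (\<eta> * ?h)) powr (- \<alpha>) = \<eta> powr \<alpha>"
    proof -
      have "?h / (\<eta> * ?h) = inverse \<eta>" using h(1) by (simp add: field_simps)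
      then show ?thesis using \<eta>(1) by (simp add: powr_minus inverse_powr)
    qed
    also have "C * \<eta> powr \<alpha> * measure lebesgue (ball x R) \<le> (\<bar>C\<bar> * w) * (G * l ^ CARD('n))"
    proof (rule mult_mono)
      show "C * \<eta> powr \<alpha> \<le> \<bar>C\<bar> * w" using \<eta>w by (intro mult_mono) auto
      have "measure lebesgue (ball x R) \<le> measure lebesgue (half_open_cube (\<chi> i. x $ i - R) (2 * R))"
        using R by (intro measure_mono_fmeasurable ball_subset_cube cube_measure) auto
      also have "\<dots> = (2 * R) ^ CARD('n)" using R by (simp add: cube_measure(2))
      also have "2 * R = 2 * (real CARD('n) + 1) * l" by (simp only: R_def mult.assoc)
      also have "(2 * (real CARD('n) + 1) * l) ^ CARD('n) = G * l ^ CARD('n)"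
        unfolding G_def by (rule power_mult_distrib)
      finally show "measure lebesgue (ball x R) \<le> G * l ^ CARD('n)" .
    qed (use w in auto)
    also have "\<dots> = (\<bar>C\<bar> * w * G) * l ^ CARD('n)" by simp
    also have "\<dots> \<le> 1 / 2 * l ^ CARD('n)" using CwG l by (intro mult_right_mono) auto
    finally show "measure lebesgue (neighbourhood E (\<eta> * max_hole E (ball x ((real CARD('n) + 1) * l))) \<inter> half_open_cube a l)
         \<le> l ^ CARD('n) / 2" unfolding R_def by simp
  qed
  with \<eta> show ?thesis using that by blast
qed

text \<open>
  All selected cubes have the same generation. If the cube meets \<open>E\<close>, its side is comparable
  with \<open>min l r\<close>, where \<open>r = \<eta> * h\<close>, and every free cube of side \<open>t\<close> contained in the given
  cube satisfies \<open>t \<le> l\<close> and \<open>t \<le> 2 * h\<close>.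
\<close>

lemma Mu_exponent_imp_abundant_holes:
  fixes E :: "(real ^ 'n) set"
  assumes E: "E \<noteq> {}" and \<alpha>: "\<alpha> \<in> Mu_exponents E" "\<alpha> > 0"
    and pos: "\<And>x R. x \<in> E \<Longrightarrow> R > 0 \<Longrightarrow> max_hole E (ball x R) > 0"
  obtains \<kappa> where "0 < \<kappa>" "\<kappa> < 1" "abundant_holes (1 / 2) \<kappa> E"
proof -
  let ?n = "real CARD('n)"
  obtain \<eta> where \<eta>: "0 < \<eta>" "\<eta> < 1" and sparse:
    "\<And>x a l. \<lbrakk>l > 0; x \<in> E \<inter> half_open_cube a l\<rbrakk> \<Longrightarrow>
       half_open_cube a l \<subseteq> ball x ((?n + 1) * l) \<and>
       measure lebesgue (neighbourhood E (\<eta> * max_hole E (ball x ((?n + 1) * l))) \<inter> half_open_cube a l)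
         \<le> l ^ CARD('n) / 2"
    using Mu_exponent_imp_sparse_neighbourhood[OF \<alpha> pos] by blast
  define \<kappa> where "\<kappa> = \<eta> / (4 * ?n)"
  have n: "?n \<ge> 1" by (simp add: Suc_leI)
  have "\<eta> < 4 * ?n" using \<eta> n by linarith
  then have \<kappa>: "0 < \<kappa>" "\<kappa> < 1" using \<eta> by (simp_all add: \<kappa>_def)
  have "abundant_holes (1 / 2) \<kappa> E"
    unfolding abundant_holes_def
  proof (intro allI impI)
    fix a :: "real ^ 'n" and l :: real assume l: "l > 0"
    let ?P = "half_open_cube a l"
    have cube: "is_cube ?P" using l by (auto simp: is_cube_def)
    have "\<exists>j. 1 / 2 * l ^ CARD('n) \<le> (\<Sum>Q\<in>{Q \<in> dyadic_gen j ?P. E \<inter> Q = {}}. measure lebesgue Q) \<and>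
        (\<forall>z t. t > 0 \<longrightarrow> half_open_cube z t \<subseteq> ?P - E \<longrightarrow> \<kappa> * t \<le> l / 2 ^ j)"
    proof (cases "E \<inter> ?P = {}")
      case True
      then have "{Q \<in> dyadic_gen 0 ?P. E \<inter> Q = {}} = {?P}" using dyadic_gen_0[OF l] by auto
      moreover have "\<kappa> * t \<le> l" if t: "t > 0" "half_open_cube z t \<subseteq> ?P - E" for z t
      proof -
        have "half_open_cube z t \<subseteq> ?P" using t by blast
        then have "t \<le> l" by (rule cube_subset_side[OF t(1)])
        moreover have "\<kappa> * t \<le> 1 * t" using \<kappa> t by (intro mult_right_mono) auto
        ultimately show ?thesis by simp
      qed
      ultimately show ?thesis using l by (intro exI[of _ 0]) (simp add: cube_measure(2))
    next
      case False
      then obtain x where x: "x \<in> E \<inter> ?P" by blast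
      define R where "R = (?n + 1) * l"
      define h where "h = max_hole E (ball x R)"
      define r where "r = \<eta> * h"
      have PB: "?P \<subseteq> ball x R" and half: "measure lebesgue (neighbourhood E r \<inter> ?P) \<le> l ^ CARD('n) / 2"
        using sparse[OF l x] unfolding r_def h_def R_def by auto
      have h: "h > 0" unfolding h_def R_def using x l by (intro pos) auto
      then have "r > 0" using \<eta> by (simp add: r_def)
      then obtain j where j: "l / 2 ^ j \<le> r / ?n" "min l (r / ?n / 2) \<le> l / 2 ^ j"
        using dyadic_scale[of l "r / ?n"] l by auto
      let ?F = "{Q \<in> dyadic_gen j ?P. E \<inter> Q = {}}"
      have fin: "finite ?F" by (rule finite_subset[OF _ finite_dyadic_gen[OF l]]) blast
      have meas: "Q \<in> lmeasurable" if "Q \<in> ?F" for Q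
        using that l by (auto elim!: dyadic_genE[OF l] intro: cube_measure(1))
      have "?n * (l / 2 ^ j) \<le> r" using j(1) n by (simp add: field_simps)
      from dyadic_cubes_outside_neighbourhood[OF E l this]
      have cover: "?P \<subseteq> (neighbourhood E r \<inter> ?P) \<union> \<Union> ?F" by blast
      have U: "\<Union> ?F \<in> sets lebesgue"
        using meas fin by (intro sets.finite_Union) (auto dest: fmeasurableD)
      have NP: "neighbourhood E r \<inter> ?P \<in> lmeasurable"
        using cube_measure(1)[of l a] l by (subst Int_commute) (auto intro: fmeasurable_Int_fmeasurable)
      have "l ^ CARD('n) = measure lebesgue ?P" using l by (simp add: cube_measure(2))
      also have "\<dots> \<le> measure lebesgue ((neighbourhood E r \<inter> ?P) \<union> \<Union> ?F)"
        using cover fin meas NP l cube_measure(1)[of l a]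
        by (intro measure_mono_fmeasurable fmeasurable.Un fmeasurable.finite_Union) (auto dest: fmeasurableD)
      also have "\<dots> \<le> measure lebesgue (neighbourhood E r \<inter> ?P) + measure lebesgue (\<Union> ?F)"
        using U NP by (intro measure_Un_le) (auto dest: fmeasurableD)
      also have "measure lebesgue (\<Union> ?F) \<le> (\<Sum>Q\<in>?F. measure lebesgue Q)"
        using fin meas by (intro measure_Union_le) (auto dest: fmeasurableD)
      finally have "1 / 2 * l ^ CARD('n) \<le> (\<Sum>Q\<in>?F. measure lebesgue Q)" using half by simp
      moreover have "\<kappa> * t \<le> l / 2 ^ j" if t: "t > 0" "half_open_cube z t \<subseteq> ?P - E" for z t
      proof -
        have "half_open_cube z t \<subseteq> ?P" using t by blast
        then have tl: "t \<le> l" by (rule cube_subset_side[OF t(1)])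
        have "half_open_cube z t \<subseteq> ball x R - E" using t PB by blast
        then have "t / 2 \<le> h"
          unfolding h_def using t by (intro le_max_hole[OF _ ball_subset_centred_cube]) auto
        then have "\<kappa> * t \<le> \<kappa> * (2 * h)" using \<kappa> by (intro mult_left_mono) auto
        also have "\<dots> = r / ?n / 2" by (simp add: \<kappa>_def r_def)
        finally have "\<kappa> * t \<le> r / ?n / 2" .
        moreover have "\<kappa> * t \<le> 1 * t" using \<kappa> t by (intro mult_right_mono) auto
        ultimately show ?thesis using tl j(2) by linarith
      qed
      ultimately show ?thesis by blast
    qed
    then obtain j where tot: "1 / 2 * l ^ CARD('n) \<le> (\<Sum>Q\<in>{Q \<in> dyadic_gen j ?P. E \<inter> Q = {}}. measure lebesgue Q)"
      and side: "\<And>z t. t > 0 \<Longrightarrow> half_open_cube z t \<subseteq> ?P - E \<Longrightarrow> \<kappa> * t \<le> l / 2 ^ j"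
      by blast
    let ?F = "{Q \<in> dyadic_gen j ?P. E \<inter> Q = {}}"
    have "finite ?F" by (rule finite_subset[OF _ finite_dyadic_gen[OF l]]) blast
    moreover have "disjoint ?F" using disjoint_dyadic_gen[OF cube, of j] by (simp add: disjoint_def)
    moreover have "?F \<subseteq> free_dyadic E ?P" unfolding free_dyadic_def dyadic_def by blast
    moreover have "\<exists>b u. Q = half_open_cube b u \<and> u > 0 \<and>
         (\<forall>z t. t > 0 \<longrightarrow> half_open_cube z t \<subseteq> ?P - E \<longrightarrow> \<kappa> * t \<le> u)" if Q: "Q \<in> ?F" for Q
    proof -
      have "Q \<in> dyadic_gen j ?P" using Q by simp
      from dyadic_genE[OF l this] obtain b where b: "Q = half_open_cube b (l / 2 ^ j)" .
      show ?thesis using b l side by (intro exI[of _ b] exI[of _ "l / 2 ^ j"]) simp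
    qed
    ultimately show "\<exists>F. finite F \<and> disjoint F \<and> F \<subseteq> free_dyadic E ?P \<and>
        (\<forall>Q \<in> F. \<exists>b u. Q = half_open_cube b u \<and> u > 0 \<and>
           (\<forall>z t. t > 0 \<longrightarrow> half_open_cube z t \<subseteq> ?P - E \<longrightarrow> \<kappa> * t \<le> u)) \<and>
        1 / 2 * l ^ CARD('n) \<le> (\<Sum>Q\<in>F. measure lebesgue Q)"
      using tot by blast
  qed
  with \<kappa> show ?thesis using that by blast
qed

section \<open>Neighbourhoods in free cubes\<close>

text \<open>
  Only the shell of width \<open>r\<close> along the faces of a free cube can be closer than \<open>r\<close> to \<open>E\<close>,
  because a point of \<open>E\<close> lies outside the cube.
\<close>

lemma neighbourhood_Int_free_cube:
  fixes E :: "(real ^ 'n) set"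
  assumes E: "E \<noteq> {}" and "s > 0" "r > 0" and free: "E \<inter> half_open_cube b s = {}"
  shows "measure lebesgue (neighbourhood E r \<inter> half_open_cube b s)
    \<le> real CARD('n) * (2 * r / s) * s ^ CARD('n)"
proof -
  let ?K = "half_open_cube (\<chi> i. b $ i + r) (s - 2 * r)"
  have K: "?K \<subseteq> half_open_cube b s"
  proof
    fix y assume "y \<in> ?K"
    then have y: "b $ i + r \<le> y $ i" "y $ i < b $ i + r + (s - 2 * r)" for i
      by (simp_all add: half_open_cube_def)
    have "b $ i \<le> y $ i \<and> y $ i < b $ i + s" for i
      using y[of i] \<open>r > 0\<close> by linarith
    then show "y \<in> half_open_cube b s" by (simp add: half_open_cube_def)
  qed
  have far: "r \<le> infdist y E" if y: "y \<in> ?K" for y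
  proof -
    have "r \<le> dist y e" if e: "e \<in> E" for e
    proof (rule ccontr)
      assume "\<not> r \<le> dist y e"
      then have d: "norm (y - e) < r" by (simp add: dist_norm)
      have "b $ i \<le> e $ i \<and> e $ i < b $ i + s" for i
      proof -
        have "b $ i + r \<le> y $ i" "y $ i < b $ i + r + (s - 2 * r)"
          using y by (simp_all add: half_open_cube_def)
        moreover have "\<bar>y $ i - e $ i\<bar> < r" using component_le_norm_cart[of "y - e" i] d by simp
        ultimately show ?thesis by linarith
      qed
      then show False using free e by (auto simp: half_open_cube_def)
    qed
    then show ?thesis using E by (simp add: infdist_notempty cINF_greatest)
  qed
  have "measure lebesgue (neighbourhood E r \<inter> half_open_cube b s) \<le> measure lebesgue (half_open_cube b s - ?K)"
  proof (rule measure_mono_fmeasurable)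
    show "neighbourhood E r \<inter> half_open_cube b s \<subseteq> half_open_cube b s - ?K"
      using far by (force simp: neighbourhood_def)
    have Q: "half_open_cube b s \<in> lmeasurable" using assms by (intro cube_measure) auto
    then show "neighbourhood E r \<inter> half_open_cube b s \<in> sets lebesgue" by (auto dest: fmeasurableD)
    have "?K \<in> sets lebesgue"
    proof (cases "s - 2 * r \<ge> 0")
      case True then show ?thesis using cube_measure(1) by (blast dest: fmeasurableD)
    next
      case False
      have "?K = {}"
      proof -
        have "\<not> (b $ i + r \<le> x $ i \<and> x $ i < b $ i + r + (s - 2 * r))" for x and i :: 'n
          using False by linarith
        then show ?thesis unfolding half_open_cube_def by simp
      qed
      then show ?thesis by simp
    qed
    with Q show "half_open_cube b s - ?K \<in> lmeasurable" by (rule fmeasurable_Diff)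
  qed
  also have "\<dots> \<le> real CARD('n) * (2 * r / s) * s ^ CARD('n)"
    using assms by (intro shell_measure[OF _ _ K]) auto
  finally show ?thesis .
qed

section \<open>Holes of neighbouring cubes are comparable\<close>

definition cube_has_hole :: "(real ^ 'n) set \<Rightarrow> real ^ 'n \<Rightarrow> real \<Rightarrow> real \<Rightarrow> bool" where
  "cube_has_hole E a l t \<longleftrightarrow> (\<exists>z. half_open_cube z t \<subseteq> half_open_cube a l - E)"

lemma cube_has_hole_mono: "cube_has_hole E a l u \<Longrightarrow> t \<le> u \<Longrightarrow> cube_has_hole E a l t"
  unfolding cube_has_hole_def using cube_mono by blast

text \<open>
  The intersection is a box with sides at most \<open>u\<close>. If its volume is at least \<open>e * u ^ n\<close>,
  then no single side can be shorter than \<open>e * u\<close>.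
\<close>

lemma cube_Int_contains_cube:
  fixes a q :: "real ^ 'n"
  assumes "u > 0" "e > 0"
    and big: "e * u ^ CARD('n) \<le> measure lebesgue (half_open_cube q u \<inter> half_open_cube a s)"
  shows "\<exists>z. half_open_cube z (e * u) \<subseteq> half_open_cube q u \<inter> half_open_cube a s"
proof -
  define lo where "lo = (\<chi> i. max (q $ i) (a $ i))"
  define hi where "hi = (\<chi> i. min (q $ i + u) (a $ i + s))"
  have eq: "half_open_cube q u \<inter> half_open_cube a s = {x. \<forall>i. lo $ i \<le> x $ i \<and> x $ i < hi $ i}"
    unfolding lo_def hi_def half_open_cube_def by auto
  have "0 < e * u ^ CARD('n)" using assms by simp
  then have "half_open_cube q u \<inter> half_open_cube a s \<noteq> {}" using big by auto
  then obtain x where x: "\<And>i. lo $ i \<le> x $ i \<and> x $ i < hi $ i" unfolding eq by blast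
  have le: "lo $ i \<le> hi $ i" for i using x[of i] by linarith
  have vol: "e * u ^ CARD('n) \<le> (\<Prod>i\<in>UNIV. hi $ i - lo $ i)"
    using big half_open_box_measure(2)[of lo hi, OF le] unfolding eq by simp
  have side: "e * u \<le> hi $ j - lo $ j" for j
  proof -
    have "e * u ^ CARD('n) \<le> (hi $ j - lo $ j) * (\<Prod>i\<in>UNIV - {j}. hi $ i - lo $ i)"
      using vol by (simp add: prod.remove[of UNIV j])
    also have "(\<Prod>i\<in>UNIV - {j}. hi $ i - lo $ i) \<le> (\<Prod>i\<in>UNIV - {j}. u)"
      using le by (intro prod_mono) (auto simp: lo_def hi_def)
    also have "\<dots> = u ^ (CARD('n) - 1)" by (simp add: card_Diff_singleton)
    finally have "e * u ^ CARD('n) \<le> (hi $ j - lo $ j) * u ^ (CARD('n) - 1)"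
      using le[of j] by (simp add: mult_left_mono)
    moreover have "u ^ CARD('n) = u * u ^ (CARD('n) - 1)"
      by (simp flip: power_Suc)
    ultimately have "(e * u) * u ^ (CARD('n) - 1) \<le> (hi $ j - lo $ j) * u ^ (CARD('n) - 1)" by simp
    then show ?thesis by (rule mult_right_le_imp_le) (use assms in simp)
  qed
  have "half_open_cube lo (e * u) \<subseteq> half_open_cube q u \<inter> half_open_cube a s"
    unfolding eq
  proof
    fix x assume "x \<in> half_open_cube lo (e * u)"
    then have "lo $ i \<le> x $ i" "x $ i < lo $ i + e * u" for i by (simp_all add: half_open_cube_def)
    then show "x \<in> {x. \<forall>i. lo $ i \<le> x $ i \<and> x $ i < hi $ i}" using side by (smt (verit) mem_Collect_eq)
  qed
  then show ?thesis by blast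
qed

text \<open>
  The free cubes selected in the old cube have total volume at least \<open>c * s ^ n\<close>, and the
  translation loses at most half of that. Hence some selected cube keeps the proportion
  \<open>c / 2\<close> of its volume, and by \<open>cube_Int_contains_cube\<close> a cube of \<open>c / 2\<close> times its side.
  Selected cubes are as large as \<open>\<kappa> * t\<close>; an arbitrary hole of the old cube might be lost
  altogether, which is why the abundance is essential.
\<close>

lemma hole_small_translation:
  fixes E :: "(real ^ 'n) set"
  assumes holes: "abundant_holes c \<kappa> E" and c: "0 < c" "c < 1" and \<kappa>: "0 < \<kappa>"
    and s: "s > 0" and t: "t > 0" and \<tau>: "0 \<le> \<tau>" "real CARD('n) * \<tau> \<le> c / 2"
    and near: "\<And>i. \<bar>b $ i - a $ i\<bar> \<le> \<tau> * s" and hole: "cube_has_hole E b s t"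
  shows "cube_has_hole E a s (c / 2 * \<kappa> * t)"
proof -
  let ?A = "half_open_cube a s" and ?B = "half_open_cube b s"
  obtain F where F: "finite F" "disjoint F" "F \<subseteq> free_dyadic E ?B"
    and side: "\<And>Q. Q \<in> F \<Longrightarrow> \<exists>q u. Q = half_open_cube q u \<and> u > 0 \<and>
       (\<forall>z t. t > 0 \<longrightarrow> half_open_cube z t \<subseteq> ?B - E \<longrightarrow> \<kappa> * t \<le> u)"
    and tot: "c * s ^ CARD('n) \<le> (\<Sum>Q\<in>F. measure lebesgue Q)"
    by (fact abundant_holesE[OF holes s, of b])
  have meas: "Q \<in> lmeasurable" if Q: "Q \<in> F" for Q
    using side[OF Q] cube_measure(1) by (metis less_imp_le)
  have A: "?A \<in> lmeasurable" and B: "?B \<in> lmeasurable" using s by (simp_all add: cube_measure(1))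
  have "\<tau> \<le> real CARD('n) * \<tau>" using \<tau>(1) by (simp add: mult_le_cancel_right1 Suc_leI)
  then have "\<tau> < 1" using \<tau> c by linarith
  have "half_open_cube (\<chi> i. max (a $ i) (b $ i)) (s - \<tau> * s) \<subseteq> ?A \<inter> ?B"
  proof
    fix x assume "x \<in> half_open_cube (\<chi> i. max (a $ i) (b $ i)) (s - \<tau> * s)"
    then have x: "max (a $ i) (b $ i) \<le> x $ i" "x $ i < max (a $ i) (b $ i) + (s - \<tau> * s)" for i
      by (simp_all add: half_open_cube_def)
    have "a $ i \<le> x $ i \<and> x $ i < a $ i + s \<and> b $ i \<le> x $ i \<and> x $ i < b $ i + s" for i
      using x[of i] near[of i] \<tau>(1) s by (auto simp: max_def abs_le_iff split: if_splits)
    then show "x \<in> ?A \<inter> ?B" by (simp add: half_open_cube_def)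
  qed
  then obtain z where z: "half_open_cube z (s - \<tau> * s) \<subseteq> ?A" "half_open_cube z (s - \<tau> * s) \<subseteq> ?B"
    by blast
  have "measure lebesgue (?B - ?A) \<le> measure lebesgue (?B - half_open_cube z (s - \<tau> * s))"
  proof (rule measure_mono_fmeasurable)
    have "half_open_cube z (s - \<tau> * s) \<in> lmeasurable"
      using \<open>\<tau> < 1\<close> s by (intro cube_measure(1)) simp
    then show "?B - half_open_cube z (s - \<tau> * s) \<in> lmeasurable" using B by (blast intro: fmeasurable_Diff dest: fmeasurableD)
  qed (use z A B in \<open>auto dest: fmeasurableD\<close>)
  also have "\<dots> \<le> real CARD('n) * (\<tau> * s / s) * s ^ CARD('n)"
    by (rule shell_measure[OF s _ z(2)]) (use \<tau> s in simp)
  also have "\<dots> \<le> c / 2 * s ^ CARD('n)"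
    using \<tau> s by (intro mult_right_mono) auto
  finally have new: "measure lebesgue (?B - ?A) \<le> c / 2 * s ^ CARD('n)" .
  define S where "S = (\<Sum>Q\<in>F. measure lebesgue Q)"
  have out: "(\<Sum>Q\<in>F. measure lebesgue (Q - ?A)) \<le> S / 2"
  proof -
    have "(\<Sum>Q\<in>F. measure lebesgue (Q - ?A)) = measure lebesgue (\<Union>Q\<in>F. Q - ?A)"
    proof (rule measure_UNION'[symmetric, OF F(1)])
      show "Q - ?A \<in> lmeasurable" if "Q \<in> F" for Q
        using meas[OF that] A by (blast intro: fmeasurable_Diff dest: fmeasurableD)
      show "pairwise (\<lambda>Q R. disjnt (Q - ?A) (R - ?A)) F"
        using F(2) unfolding pairwise_def disjnt_def disjoint_def by blast
    qed
    also have "\<dots> \<le> measure lebesgue (?B - ?A)"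
    proof (rule measure_mono_fmeasurable)
      show "(\<Union>Q\<in>F. Q - ?A) \<subseteq> ?B - ?A"
      proof -
        have "Q \<subseteq> ?B" if "Q \<in> F" for Q
          using free_dyadicE[OF s, of Q E b] F(3) that by (metis Diff_subset order_trans subsetD)
        then show ?thesis by blast
      qed
      show "(\<Union>Q\<in>F. Q - ?A) \<in> sets lebesgue"
        using F(1) meas A by (intro sets.finite_UN) (auto dest: fmeasurableD)
      show "?B - ?A \<in> lmeasurable" using A B by (blast intro: fmeasurable_Diff dest: fmeasurableD)
    qed
    also have "\<dots> \<le> S / 2" using new tot unfolding S_def by simp
    finally show ?thesis .
  qed
  have Spos: "S > 0"
  proof -
    have "0 < c * s ^ CARD('n)" using c s by simp
    then show ?thesis using tot unfolding S_def by linarith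
  qed
  \<comment> \<open>If every selected cube kept less than the proportion \<open>c / 2\<close>, then the total volume \<open>S\<close>
    would be at most \<open>c / 2 * S + S / 2 < S\<close>.\<close>
  have "\<exists>Q\<in>F. c / 2 * measure lebesgue Q \<le> measure lebesgue (Q \<inter> ?A)"
  proof (rule ccontr)
    assume "\<not> ?thesis"
    then have small: "measure lebesgue (Q \<inter> ?A) \<le> c / 2 * measure lebesgue Q" if "Q \<in> F" for Q
      using that by force
    have "S = (\<Sum>Q\<in>F. measure lebesgue (Q \<inter> ?A) + measure lebesgue (Q - ?A))"
      unfolding S_def
    proof (rule sum.cong[OF refl])
      fix Q assume "Q \<in> F"
      have "measure lebesgue ((Q \<inter> ?A) \<union> (Q - ?A)) = measure lebesgue (Q \<inter> ?A) + measure lebesgue (Q - ?A)"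
        using meas[OF \<open>Q \<in> F\<close>] A
        by (intro measure_Un3[THEN trans])
           (auto intro: fmeasurable_Diff fmeasurable_Int_fmeasurable dest: fmeasurableD simp: Int_Diff_disjoint)
      then show "measure lebesgue Q = measure lebesgue (Q \<inter> ?A) + measure lebesgue (Q - ?A)"
        by (simp add: Int_Diff_Un)
    qed
    also have "\<dots> \<le> (\<Sum>Q\<in>F. c / 2 * measure lebesgue Q + measure lebesgue (Q - ?A))"
      using small by (intro sum_mono) auto
    also have "\<dots> = c / 2 * S + (\<Sum>Q\<in>F. measure lebesgue (Q - ?A))"
      unfolding S_def by (simp add: sum.distrib sum_distrib_left)
    also have "\<dots> \<le> c / 2 * S + S / 2" using out by simp
    also have "\<dots> < S"
    proof -
      have "c * S < 1 * S" using c Spos by (intro mult_strict_right_mono)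
      then show ?thesis by simp
    qed
    finally show False by simp
  qed
  then obtain Q where Q: "Q \<in> F" "c / 2 * measure lebesgue Q \<le> measure lebesgue (Q \<inter> ?A)" by blast
  obtain q u where u: "Q = half_open_cube q u" "u > 0"
    and kt: "\<And>z t. t > 0 \<Longrightarrow> half_open_cube z t \<subseteq> ?B - E \<Longrightarrow> \<kappa> * t \<le> u"
    using side[OF Q(1)] by blast
  have "\<kappa> * t \<le> u" using hole t kt unfolding cube_has_hole_def by blast
  then have "c / 2 * \<kappa> * t \<le> c / 2 * u" using c by simp
  moreover have "\<exists>z. half_open_cube z (c / 2 * u) \<subseteq> Q \<inter> ?A"
    using Q(2) u c cube_Int_contains_cube[of u "c / 2" q a s] by (simp add: cube_measure(2))
  moreover have "E \<inter> Q = {}" using Q(1) F(3) unfolding free_dyadic_def by blast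
  ultimately show ?thesis
    using cube_has_hole_mono[of E a s "c / 2 * u"] unfolding cube_has_hole_def by blast
qed

text \<open>
  Move in \<open>N\<close> steps along the segment between the corners; the condition on \<open>N\<close> makes each
  step short enough for \<open>hole_small_translation\<close>.
\<close>

lemma hole_translation:
  fixes E :: "(real ^ 'n) set"
  assumes holes: "abundant_holes c \<kappa> E" and c: "0 < c" "c < 1" and \<kappa>: "0 < \<kappa>"
    and s: "s > 0" and t: "t > 0" and N: "N > 0" "real CARD('n) / real N \<le> c / 2"
    and near: "\<And>i. \<bar>b $ i - a $ i\<bar> \<le> s" and hole: "cube_has_hole E b s t"
  shows "cube_has_hole E a s ((c / 2 * \<kappa>) ^ N * t)"
proof -
  define p where "p m = b + (real m / real N) *\<^sub>R (a - b)" for m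
  have "cube_has_hole E (p m) s ((c / 2 * \<kappa>) ^ m * t)" for m
  proof (induction m)
    case 0
    then show ?case using hole by (simp add: p_def)
  next
    case (Suc m)
    have step: "\<bar>p m $ i - p (Suc m) $ i\<bar> \<le> 1 / real N * s" for i
    proof -
      have "p m $ i - p (Suc m) $ i = (b $ i - a $ i) / real N"
        by (simp add: p_def field_simps add_divide_distrib diff_divide_distrib)
      then show ?thesis using near[of i] N(1) by (simp add: abs_divide divide_right_mono)
    qed
    have "cube_has_hole E (p (Suc m)) s (c / 2 * \<kappa> * ((c / 2 * \<kappa>) ^ m * t))"
      by (rule hole_small_translation[OF holes c \<kappa> s _ _ _ step Suc.IH])
         (use N c \<kappa> t in simp_all)
    then show ?case by (simp add: mult.assoc)
  qed
  from this[of N] show ?thesis using N(1) by (simp add: p_def)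
qed

text \<open>
  Half of the hole, namely the cube of side \<open>t / 2\<close> with the same corner, fits into some
  translate of the child inside the parent; this translate is at distance at most \<open>s\<close> from the
  child in every coordinate.
\<close>

lemma hole_parent_to_child:
  fixes E :: "(real ^ 'n) set"
  assumes holes: "abundant_holes c \<kappa> E" and c: "0 < c" "c < 1" and \<kappa>: "0 < \<kappa>"
    and s: "s > 0" and t: "t > 0" and N: "N > 0" "real CARD('n) / real N \<le> c / 2"
    and child: "half_open_cube a s \<subseteq> half_open_cube p (2 * s)"
    and hole: "cube_has_hole E p (2 * s) t"
  shows "cube_has_hole E a s ((c / 2 * \<kappa>) ^ N / 2 * t)"
proof -
  obtain z where z: "half_open_cube z t \<subseteq> half_open_cube p (2 * s) - E"
    using hole unfolding cube_has_hole_def by blast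
  then have "half_open_cube z t \<subseteq> half_open_cube p (2 * s)" by blast
  then have zp: "p $ i \<le> z $ i \<and> z $ i + t \<le> p $ i + 2 * s" for i
    using cube_subset_iff[OF t] by blast
  have ap: "p $ i \<le> a $ i \<and> a $ i + s \<le> p $ i + 2 * s" for i
    using child cube_subset_iff[OF s] by blast
  define b where "b = (\<chi> i. min (z $ i) (p $ i + s))"
  have "t / 2 > 0" using t by simp
  have "half_open_cube z (t / 2) \<subseteq> half_open_cube b s"
    unfolding cube_subset_iff[OF \<open>t / 2 > 0\<close>]
  proof
    fix i
    show "b $ i \<le> z $ i \<and> z $ i + t / 2 \<le> b $ i + s"
      using zp[of i] t s by (auto simp: b_def min_def)
  qed
  moreover have "half_open_cube z (t / 2) \<subseteq> half_open_cube z t" using t by (intro cube_mono) simp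
  ultimately have "cube_has_hole E b s (t / 2)" unfolding cube_has_hole_def using z by blast
  moreover have "\<bar>b $ i - a $ i\<bar> \<le> s" for i
    using zp[of i] ap[of i] by (auto simp: b_def min_def)
  ultimately show ?thesis
    using hole_translation[OF holes c \<kappa> s \<open>t / 2 > 0\<close> N, of b a] by simp
qed

section \<open>Measure of a neighbourhood in a cube with a large hole\<close>

text \<open>
  The maximal dyadic cubes disjoint from the selected family \<open>F\<close> are never written down: the
  induction subdivides a cube as long as it properly contains a selected cube. A cube in which
  the subdivision stops is either selected or contains no selected cube while its parent does,
  and then the assumption \<open>parent\<close> applies. That assumption quantifies over cubes of side \<open>s\<close>
  in arbitrary cubes of side \<open>2 * s\<close>, dyadic or not, to make the induction hypothesis
  applicable to the children. The last assumption covers the case that the initial cube, whose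
  parent is not available, contains no selected cube.
\<close>

lemma stopping_time_estimate:
  fixes a :: "real ^ 'n"
  assumes A: "A \<in> sets lebesgue"
    and parent: "\<And>b p s Q. \<lbrakk>s > 0; Q \<in> F; Q \<subseteq> half_open_cube p (2 * s);
        half_open_cube b s \<subseteq> half_open_cube p (2 * s)\<rbrakk> \<Longrightarrow>
      measure lebesgue (A \<inter> half_open_cube b s) \<le> \<beta> * s ^ CARD('n)"
    and selected: "\<And>Q. Q \<in> F \<Longrightarrow> measure lebesgue (A \<inter> Q) \<le> \<beta>' * measure lebesgue Q"
    and "l > 0" "finite F" "disjoint F" "F \<subseteq> (\<Union>i\<le>J. dyadic_gen i (half_open_cube a l))"
    and "F = {} \<Longrightarrow> measure lebesgue (A \<inter> half_open_cube a l) \<le> \<beta> * l ^ CARD('n)"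
  shows "measure lebesgue (A \<inter> half_open_cube a l)
    \<le> \<beta>' * (\<Sum>Q\<in>F. measure lebesgue Q) + \<beta> * (l ^ CARD('n) - (\<Sum>Q\<in>F. measure lebesgue Q))"
  using assms(2-)
proof (induction J arbitrary: a l F)
  case 0
  let ?P = "half_open_cube a l"
  have "F \<subseteq> {?P}" using "0.prems"(6) dyadic_gen_0[OF "0.prems"(3)] by auto
  then consider "F = {}" | "F = {?P}" by blast
  then show ?case
  proof cases
    case 1 then show ?thesis using "0.prems"(7) by simp
  next
    case 2 then show ?thesis using "0.prems"(2,3) by (simp add: cube_measure(2))
  qed
next
  case (Suc J)
  note parent = Suc.prems(1) and selected = Suc.prems(2) and l = Suc.prems(3) and fin = Suc.prems(4)
    and disj = Suc.prems(5) and sub = Suc.prems(6) and empty = Suc.prems(7)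
  let ?P = "half_open_cube a l" and ?m = "measure lebesgue"
  have cube: "is_cube ?P" using l by (auto simp: is_cube_def)
  have nonempty_sub: "Q \<noteq> {} \<and> Q \<subseteq> ?P" if Q: "Q \<in> F" for Q
  proof -
    obtain i where "Q \<in> dyadic_gen i ?P" using sub Q by blast
    from dyadic_genE[OF l this] obtain b where "Q = half_open_cube b (l / 2 ^ i)" "Q \<subseteq> ?P" .
    then show ?thesis using corner_in_cube[of "l / 2 ^ i" b] l by auto
  qed
  show ?case
  proof (cases "F = {} \<or> ?P \<in> F")
    case True
    then show ?thesis
    proof
      assume "F = {}" then show ?thesis using empty by simp
    next
      assume P: "?P \<in> F"
      have "F = {?P}"
      proof (rule ccontr)
        assume "F \<noteq> {?P}"
        then obtain Q where Q: "Q \<in> F" "Q \<noteq> ?P" using P by blast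
        then have "Q \<inter> ?P = {}" by (intro disjointD[OF disj Q(1) P])
        then show False using nonempty_sub[OF Q(1)] by blast
      qed
      then show ?thesis using selected[OF P] l by (simp add: cube_measure(2))
    qed
  next
    case False
    define D where "D = dyadic_gen 1 ?P"
    define G where "G R = {Q \<in> F. Q \<subseteq> R}" for R
    have D: "finite D" "disjoint D" "\<Union> D = ?P" "card D = 2 ^ (1 * CARD('n))"
      unfolding D_def by (rule finite_dyadic_gen[OF l] disjoint_dyadic_gen[OF cube]
        Union_dyadic_gen[OF cube] card_dyadic_gen[OF cube])+
    have shape: "\<exists>b. R = half_open_cube b (l / 2) \<and> R \<subseteq> ?P" if R: "R \<in> D" for R
    proof -
      from R have "R \<in> dyadic_gen 1 ?P" unfolding D_def .
      from dyadic_genE[OF l this] obtain b where "R = half_open_cube b (l / 2 ^ 1)" "R \<subseteq> ?P" .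
      then show ?thesis by auto
    qed
    have descend: "\<exists>R\<in>D. Q \<subseteq> R \<and> (\<exists>i\<le>J. Q \<in> dyadic_gen i R)" if Q: "Q \<in> F" for Q
    proof -
      obtain i where i: "i \<le> Suc J" "Q \<in> dyadic_gen i ?P" using sub Q by blast
      have "i \<noteq> 0"
      proof
        assume "i = 0"
        then have "Q = ?P" using i(2) dyadic_gen_0[OF l] by auto
        then show False using False Q by blast
      qed
      then obtain k where k: "i = Suc k" using not0_implies_Suc by blast
      obtain R where R: "R \<in> D" "Q \<in> dyadic_gen k R"
        using dyadic_gen_Suc[OF l i(2)[unfolded k]] unfolding D_def by blast
      obtain b where b: "R = half_open_cube b (l / 2)" using shape[OF R(1)] by blast
      have "l / 2 > 0" using l by simp
      then have "Q \<subseteq> R" using R(2) unfolding b by (rule dyadic_genE)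
      then show ?thesis using R i(1) k by auto
    qed
    have unique: "R = R'" if "R \<in> D" "R' \<in> D" "Q \<in> F" "Q \<subseteq> R" "Q \<subseteq> R'" for Q R R'
      using disjointD[OF D(2) that(1,2)] nonempty_sub[OF that(3)] that(4,5) by blast
    have IH: "?m (A \<inter> R) \<le> \<beta>' * (\<Sum>Q\<in>G R. ?m Q) + \<beta> * ((l / 2) ^ CARD('n) - (\<Sum>Q\<in>G R. ?m Q))"
      if R: "R \<in> D" for R
    proof -
      obtain b where b: "R = half_open_cube b (l / 2)" "R \<subseteq> ?P" using shape[OF R] by blast
      have GF: "G R \<subseteq> F" unfolding G_def by blast
      have gens: "G R \<subseteq> (\<Union>i\<le>J. dyadic_gen i R)"
      proof
        fix Q assume Q: "Q \<in> G R"
        then have QF: "Q \<in> F" "Q \<subseteq> R" unfolding G_def by auto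
        from descend[OF QF(1)] obtain R' i where R': "R' \<in> D" "Q \<subseteq> R'" "i \<le> J" "Q \<in> dyadic_gen i R'"
          by blast
        have "R' = R" by (rule unique[OF R'(1) R QF(1) R'(2) QF(2)])
        then show "Q \<in> (\<Union>i\<le>J. dyadic_gen i R)" using R' by blast
      qed
      show ?thesis
        unfolding b(1)
      proof (rule Suc.IH)
        show "?m (A \<inter> half_open_cube b' s) \<le> \<beta> * s ^ CARD('n)"
          if "s > 0" "Q \<in> G (half_open_cube b (l / 2))" "Q \<subseteq> half_open_cube p (2 * s)"
            "half_open_cube b' s \<subseteq> half_open_cube p (2 * s)" for b' p s Q
          using that GF b(1) by (intro parent[of s Q p b']) auto
        show "?m (A \<inter> Q) \<le> \<beta>' * ?m Q" if "Q \<in> G (half_open_cube b (l / 2))" for Q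
          using that GF b(1) by (intro selected) auto
        show "l / 2 > 0" using l by simp
        show "finite (G (half_open_cube b (l / 2)))" using fin unfolding G_def by simp
        show "disjoint (G (half_open_cube b (l / 2)))"
          using disj GF b(1) unfolding disjoint_def by blast
        show "G (half_open_cube b (l / 2)) \<subseteq> (\<Union>i\<le>J. dyadic_gen i (half_open_cube b (l / 2)))"
          using gens b(1) by simp
        show "?m (A \<inter> half_open_cube b (l / 2)) \<le> \<beta> * (l / 2) ^ CARD('n)"
        proof -
          obtain Q where Q: "Q \<in> F" using False by blast
          show ?thesis
            using l b nonempty_sub[OF Q] by (intro parent[of "l / 2" Q a b, OF _ Q]) auto
        qed
      qed
    qed
    have vol: "(\<Sum>R\<in>D. (l / 2) ^ CARD('n)) = l ^ CARD('n)"
      using D(4) by (simp add: power_divide)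
    have F_eq: "F = (\<Union>R\<in>D. G R)" unfolding G_def using descend by blast
    have sumF: "(\<Sum>Q\<in>F. ?m Q) = (\<Sum>R\<in>D. \<Sum>Q\<in>G R. ?m Q)"
    proof (subst F_eq, rule sum.UNION_disjoint)
      show "finite D" by (rule D(1))
      show "\<forall>R\<in>D. finite (G R)" using fin unfolding G_def by simp
      show "\<forall>R\<in>D. \<forall>R'\<in>D. R \<noteq> R' \<longrightarrow> G R \<inter> G R' = {}" using unique unfolding G_def by blast
    qed
    have "?m (A \<inter> ?P) = ?m (\<Union>R\<in>D. A \<inter> R)" using D(3) by (intro arg_cong[where f = ?m]) blast
    also have "\<dots> \<le> (\<Sum>R\<in>D. ?m (A \<inter> R))"
    proof (rule measure_UNION_le[OF D(1)])
      fix R assume "R \<in> D"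
      then obtain b where "R = half_open_cube b (l / 2)" using shape by blast
      then have "R \<in> lmeasurable" using l by (simp add: cube_measure(1))
      then show "A \<inter> R \<in> sets lebesgue" using A by (blast dest: fmeasurableD)
    qed
    also have "\<dots> \<le> (\<Sum>R\<in>D. \<beta>' * (\<Sum>Q\<in>G R. ?m Q) + \<beta> * ((l / 2) ^ CARD('n) - (\<Sum>Q\<in>G R. ?m Q)))"
      by (rule sum_mono[OF IH])
    also have "\<dots> = \<beta>' * (\<Sum>Q\<in>F. ?m Q) + \<beta> * (l ^ CARD('n) - (\<Sum>Q\<in>F. ?m Q))"
      unfolding sum.distrib sum_distrib_left[symmetric] sum_subtractf vol sumF ..
    finally show ?thesis .
  qed
qed

text \<open>
  One round of the iteration: the selected free cubes contribute their boundary shells, and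
  the rest, of proportion at most \<open>1 - c\<close>, consists of cubes whose holes shrank by a constant
  factor only.
\<close>

lemma neighbourhood_recurrence:
  fixes E :: "(real ^ 'n) set"
  assumes E: "E \<noteq> {}" and holes: "abundant_holes c \<kappa> E" and c: "0 < c" "c < 1" and \<kappa>: "0 < \<kappa>"
    and N: "N > 0" "real CARD('n) / real N \<le> c / 2"
    and l: "l > 0" and t: "t > 0" and r: "r > 0" and hole: "cube_has_hole E a l t"
    and "\<beta> \<ge> 0"
    and IH: "\<And>b s. \<lbrakk>s > 0; cube_has_hole E b s ((c / 2 * \<kappa>) ^ N / 2 * (\<kappa> * t))\<rbrakk> \<Longrightarrow>
      measure lebesgue (neighbourhood E r \<inter> half_open_cube b s) \<le> \<beta> * s ^ CARD('n)"
  shows "measure lebesgue (neighbourhood E r \<inter> half_open_cube a l)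
    \<le> (2 * real CARD('n) * r / (\<kappa> * t) + \<beta> * (1 - c)) * l ^ CARD('n)"
proof -
  let ?n = "real CARD('n)" and ?m = "measure lebesgue" and ?P = "half_open_cube a l"
  obtain F where F: "finite F" "disjoint F" "F \<subseteq> free_dyadic E ?P"
    and side: "\<And>Q. Q \<in> F \<Longrightarrow> \<exists>q u. Q = half_open_cube q u \<and> u > 0 \<and>
       (\<forall>z t. t > 0 \<longrightarrow> half_open_cube z t \<subseteq> ?P - E \<longrightarrow> \<kappa> * t \<le> u)"
    and tot: "c * l ^ CARD('n) \<le> (\<Sum>Q\<in>F. ?m Q)"
    by (fact abundant_holesE[OF holes l, of a])
  have Q_shape: "\<exists>q u. Q = half_open_cube q u \<and> u > 0 \<and> \<kappa> * t \<le> u \<and> Q \<subseteq> ?P \<and> E \<inter> Q = {}"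
    if Q: "Q \<in> F" for Q
  proof -
    obtain q u where u: "Q = half_open_cube q u" "u > 0"
      "\<And>z t. t > 0 \<Longrightarrow> half_open_cube z t \<subseteq> ?P - E \<Longrightarrow> \<kappa> * t \<le> u"
      using side[OF Q] by blast
    have "\<kappa> * t \<le> u" using hole t u(3) unfolding cube_has_hole_def by blast
    moreover have "Q \<in> free_dyadic E ?P" using F(3) Q by blast
    then have "Q \<subseteq> ?P - E" by (rule free_dyadic_subset[OF l])
    ultimately show ?thesis using u(1,2) by blast
  qed
  define S where "S = (\<Sum>Q\<in>F. ?m Q)"
  have S: "c * l ^ CARD('n) \<le> S" using tot by (simp add: S_def)
  have S_le: "S \<le> l ^ CARD('n)"
  proof -
    have meas: "Q \<in> lmeasurable" if "Q \<in> F" for Q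
      using Q_shape[OF that] cube_measure(1) by (metis less_imp_le)
    have "S = ?m (\<Union>F)"
      unfolding S_def using F(1,2) meas
      by (intro measure_Union'[symmetric]) (auto simp: pairwise_def disjnt_def disjoint_def)
    also have "\<dots> \<le> ?m ?P"
    proof (rule measure_mono_fmeasurable)
      show "\<Union>F \<subseteq> ?P" using Q_shape by blast
      show "\<Union>F \<in> sets lebesgue" using F(1) meas by (intro sets.finite_Union) (auto dest: fmeasurableD)
      show "?P \<in> lmeasurable" using l by (simp add: cube_measure(1))
    qed
    finally show ?thesis using l by (simp add: cube_measure(2))
  qed
  obtain J where J: "F \<subseteq> (\<Union>i\<le>J. dyadic_gen i ?P)"
  proof -
    have "\<forall>Q\<in>F. \<exists>i. Q \<in> dyadic_gen i ?P"
      using F(3) unfolding free_dyadic_def dyadic_def by blast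
    then obtain g where g: "\<And>Q. Q \<in> F \<Longrightarrow> Q \<in> dyadic_gen (g Q) ?P" by metis
    have "F \<subseteq> (\<Union>i\<le>Max (g ` F). dyadic_gen i ?P)"
    proof
      fix Q assume Q: "Q \<in> F"
      then have "g Q \<le> Max (g ` F)" using F(1) by simp
      then show "Q \<in> (\<Union>i\<le>Max (g ` F). dyadic_gen i ?P)" using g[OF Q] by blast
    qed
    then show ?thesis using that by blast
  qed
  define \<beta>' where "\<beta>' = 2 * ?n * r / (\<kappa> * t)"
  have \<beta>': "\<beta>' \<ge> 0" using \<kappa> t r by (simp add: \<beta>'_def)
  have "?m (neighbourhood E r \<inter> ?P) \<le> \<beta>' * S + \<beta> * (l ^ CARD('n) - S)"
    unfolding S_def
  proof (rule stopping_time_estimate[OF neighbourhood_measurable _ _ l F(1,2) J])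
    fix Q assume "Q \<in> F"
    then obtain q u where u: "Q = half_open_cube q u" "u > 0" "\<kappa> * t \<le> u" "E \<inter> Q = {}"
      using Q_shape by blast
    have "?m (neighbourhood E r \<inter> Q) \<le> ?n * (2 * r / u) * u ^ CARD('n)"
      unfolding u(1) using u by (intro neighbourhood_Int_free_cube E r) auto
    also have "\<dots> \<le> \<beta>' * u ^ CARD('n)"
    proof (rule mult_right_mono)
      have "2 * r / u \<le> 2 * r / (\<kappa> * t)"
        using u \<kappa> t r by (intro divide_left_mono) auto
      then have "?n * (2 * r / u) \<le> ?n * (2 * r / (\<kappa> * t))" by (intro mult_left_mono) auto
      then show "?n * (2 * r / u) \<le> \<beta>'" by (simp add: \<beta>'_def mult_ac)
    qed (use u in simp)
    also have "u ^ CARD('n) = ?m Q" using u by (simp add: cube_measure(2))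
    finally show "?m (neighbourhood E r \<inter> Q) \<le> \<beta>' * ?m Q" .
  next
    fix b p s Q
    assume s: "s > 0" and Q: "Q \<in> F" "Q \<subseteq> half_open_cube p (2 * s)"
      and child: "half_open_cube b s \<subseteq> half_open_cube p (2 * s)"
    obtain q u where u: "Q = half_open_cube q u" "u > 0" "\<kappa> * t \<le> u" "E \<inter> Q = {}"
      using Q_shape[OF Q(1)] by blast
    have "cube_has_hole E p (2 * s) u"
      unfolding cube_has_hole_def using u Q(2) by blast
    from hole_parent_to_child[OF holes c \<kappa> s u(2) N child this]
    have "cube_has_hole E b s ((c / 2 * \<kappa>) ^ N / 2 * u)" .
    moreover have "(c / 2 * \<kappa>) ^ N / 2 * (\<kappa> * t) \<le> (c / 2 * \<kappa>) ^ N / 2 * u"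
      using u(3) c \<kappa> by (intro mult_left_mono) auto
    ultimately show "?m (neighbourhood E r \<inter> half_open_cube b s) \<le> \<beta> * s ^ CARD('n)"
      using s by (intro IH) (auto intro: cube_has_hole_mono)
  next
    assume "F = {}"
    then have "S = 0" by (simp add: S_def)
    moreover have "0 < c * l ^ CARD('n)" using c l by simp
    ultimately show "?m (neighbourhood E r \<inter> ?P) \<le> \<beta> * l ^ CARD('n)" using S by simp
  qed
  also have "\<beta>' * S \<le> \<beta>' * l ^ CARD('n)" using S_le \<beta>' by (rule mult_left_mono)
  also have "\<beta> * (l ^ CARD('n) - S) \<le> \<beta> * (l ^ CARD('n) - c * l ^ CARD('n))"
    using S \<open>\<beta> \<ge> 0\<close> by (intro mult_left_mono) auto
  finally show ?thesis by (simp add: \<beta>'_def algebra_simps)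
qed

text \<open>
  With \<open>\<mu>\<close> the factor by which holes shrink in one round and \<open>\<rho> = 1 - c / 2\<close>, the exponent is
  chosen such that \<open>\<mu> powr \<alpha> = \<rho>\<close>. The bounds in the smaller cubes add up to at most
  \<open>(1 - c) / \<rho> \<le> \<rho>\<close> times the desired bound, which leaves the proportion \<open>c / 2\<close> for the
  shells; \<open>K\<close> is taken so large that they fit. The shells need \<open>\<alpha> \<le> 1\<close>, which follows from
  \<open>\<mu> \<le> 1 / 2 \<le> \<rho>\<close>.
\<close>

lemma neighbourhood_decay_in_cubes:
  fixes E :: "(real ^ 'n) set"
  assumes E: "E \<noteq> {}" and holes: "abundant_holes c \<kappa> E" and c: "0 < c" "c < 1" and \<kappa>: "0 < \<kappa>" "\<kappa> < 1"
  obtains K \<alpha> where "K > 0" "\<alpha> > 0"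
    "\<And>a l t r. \<lbrakk>l > 0; t > 0; r > 0; cube_has_hole E a l t\<rbrakk> \<Longrightarrow>
      measure lebesgue (neighbourhood E r \<inter> half_open_cube a l) \<le> K * (r / t) powr \<alpha> * l ^ CARD('n)"
proof -
  let ?n = "real CARD('n)" and ?m = "measure lebesgue"
  obtain N where "2 * ?n / c < real N" using reals_Archimedean2 by blast
  moreover from this have "0 < real N" using c by (intro le_less_trans[of 0 "2 * ?n / c"]) simp_all
  ultimately have N: "N > 0" "?n / real N \<le> c / 2" using c by (simp_all add: field_simps)
  define \<theta> where "\<theta> = (c / 2 * \<kappa>) ^ N / 2"
  define \<mu> where "\<mu> = \<theta> * \<kappa>"
  define \<rho> where "\<rho> = 1 - c / 2"
  define \<alpha> where "\<alpha> = ln \<rho> / ln \<mu>"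
  define K where "K = 1 + 4 * ?n / (\<kappa> * c)"
  have "c / 2 * \<kappa> \<le> 1 * 1" using c \<kappa> by (intro mult_mono) auto
  then have "(c / 2 * \<kappa>) ^ N \<le> 1" using c \<kappa> by (intro power_le_one) auto
  moreover have "(c / 2 * \<kappa>) ^ N > 0" using c \<kappa> by simp
  ultimately have \<theta>: "0 < \<theta>" "\<theta> \<le> 1 / 2" by (simp_all add: \<theta>_def)
  have "\<mu> \<le> 1 / 2 * 1" unfolding \<mu>_def using \<theta> \<kappa> by (intro mult_mono) auto
  then have \<mu>: "0 < \<mu>" "\<mu> \<le> 1 / 2" using \<theta> \<kappa> by (simp_all add: \<mu>_def)
  have \<rho>: "1 / 2 < \<rho>" "\<rho> < 1" using c by (simp_all add: \<rho>_def)
  have ln: "ln \<mu> \<le> ln \<rho>" "ln \<rho> < 0" using \<mu> \<rho> by simp_all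
  have \<alpha>: "0 < \<alpha>" "\<alpha> \<le> 1" using ln by (simp_all add: \<alpha>_def divide_neg_neg divide_le_eq)
  have \<mu>\<alpha>: "\<mu> powr \<alpha> = \<rho>" using ln \<mu> \<rho> by (simp add: powr_def \<alpha>_def)
  have K: "K \<ge> 1" "2 * ?n / \<kappa> \<le> K * (c / 2)" using c \<kappa> by (simp_all add: K_def field_simps)
  \<comment> \<open>Induction on the number of rounds after which the holes have size at most \<open>r\<close>; then the
    trivial bound by the full volume suffices.\<close>
  have bound: "?m (neighbourhood E r \<inter> half_open_cube a l) \<le> K * (r / t) powr \<alpha> * l ^ CARD('n)"
    if "\<mu> ^ j \<le> r / t" "l > 0" "t > 0" "r > 0" "cube_has_hole E a l t" for a l t r j
    using that
  proof (induction j arbitrary: a l t)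
    case 0
    have P: "half_open_cube a l \<in> lmeasurable" using "0.prems"(2) by (simp add: cube_measure(1))
    have "1 \<le> r / t" using "0.prems"(1) by simp
    then have "1 \<le> (r / t) powr \<alpha>" using \<alpha> by (simp add: ge_one_powr_ge_zero)
    then have "1 * 1 \<le> K * (r / t) powr \<alpha>" using K(1) by (intro mult_mono) auto
    then have "1 * l ^ CARD('n) \<le> K * (r / t) powr \<alpha> * l ^ CARD('n)"
      using "0.prems"(2) by (intro mult_right_mono) auto
    moreover have "?m (neighbourhood E r \<inter> half_open_cube a l) \<le> ?m (half_open_cube a l)"
      using P by (intro measure_mono_fmeasurable) (auto dest: fmeasurableD)
    moreover have "?m (half_open_cube a l) = 1 * l ^ CARD('n)"
      using "0.prems"(2) by (simp add: cube_measure(2))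
    ultimately show ?case by linarith
  next
    case (Suc j)
    note l = Suc.prems(2) and t = Suc.prems(3) and r = Suc.prems(4) and hole = Suc.prems(5)
    show ?case
    proof (cases "1 \<le> r / t")
      case True
      have "\<mu> ^ j \<le> 1" using \<mu> by (intro power_le_one) auto
      with True have "\<mu> ^ j \<le> r / t" by linarith
      then show ?thesis using Suc.prems by (intro Suc.IH) auto
    next
      case False
      define X where "X = (r / t) powr \<alpha>"
      have rt: "0 < r / t" "r / t < 1" using False r t by simp_all
      have "(r / t) powr 1 \<le> (r / t) powr \<alpha>"
        using rt \<alpha> by (intro powr_mono') auto
      then have rtX: "r / t \<le> X" using powr_one[OF less_imp_le[OF rt(1)]] by (simp only: X_def)
      have X: "X > 0" using rt(1) rtX by (rule less_le_trans)
      have "?m (neighbourhood E r \<inter> half_open_cube a l)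
          \<le> (2 * ?n * r / (\<kappa> * t) + K * X / \<rho> * (1 - c)) * l ^ CARD('n)"
      proof (rule neighbourhood_recurrence[OF E holes c \<kappa>(1) N l t r hole])
        show "0 \<le> K * X / \<rho>" using K X \<rho> by simp
      next
        fix b s assume s: "s > 0" and "cube_has_hole E b s ((c / 2 * \<kappa>) ^ N / 2 * (\<kappa> * t))"
        then have "cube_has_hole E b s (\<mu> * t)" by (simp only: \<mu>_def \<theta>_def mult.assoc)
        moreover have "\<mu> ^ j \<le> r / (\<mu> * t)"
          using Suc.prems(1) \<mu> t by (simp add: field_simps)
        moreover have "(r / (\<mu> * t)) powr \<alpha> = X / \<rho>"
        proof -
          have "r / (\<mu> * t) = (r / t) / \<mu>" by simp
          then have "(r / (\<mu> * t)) powr \<alpha> = (r / t) powr \<alpha> / \<mu> powr \<alpha>"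
            using rt \<mu> by (simp only: powr_divide)
          then show ?thesis using \<mu>\<alpha> by (simp only: X_def)
        qed
        ultimately show "?m (neighbourhood E r \<inter> half_open_cube b s) \<le> K * X / \<rho> * s ^ CARD('n)"
          using Suc.IH[of "\<mu> * t" s b] s \<mu> t r by simp
      qed
      also have "\<dots> \<le> (K * X) * l ^ CARD('n)"
      proof (rule mult_right_mono)
        have "2 * ?n * r / (\<kappa> * t) = 2 * ?n / \<kappa> * (r / t)" by simp
        also have "\<dots> \<le> K * (c / 2) * X" using K X rtX rt \<kappa> c by (intro mult_mono) auto
        finally have 1: "2 * ?n * r / (\<kappa> * t) \<le> K * X * (c / 2)" by (simp only: mult_ac)
        have "1 - c \<le> \<rho> * \<rho>" by (simp add: \<rho>_def algebra_simps)
        then have "K * X / \<rho> * (1 - c) \<le> K * X / \<rho> * (\<rho> * \<rho>)"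
          using K X \<rho> by (intro mult_left_mono) auto
        also have "\<dots> = K * X * (1 - c / 2)" using \<rho> by (simp add: \<rho>_def)
        finally have 2: "K * X / \<rho> * (1 - c) \<le> K * X * (1 - c / 2)" .
        have "2 * ?n * r / (\<kappa> * t) + K * X / \<rho> * (1 - c) \<le> K * X * (c / 2) + K * X * (1 - c / 2)"
          by (rule add_mono[OF 1 2])
        also have "\<dots> = K * X" by (simp add: algebra_simps)
        finally show "2 * ?n * r / (\<kappa> * t) + K * X / \<rho> * (1 - c) \<le> K * X" .
      qed (use l in simp)
      finally show ?thesis by (simp add: X_def)
    qed
  qed
  have "?m (neighbourhood E r \<inter> half_open_cube a l) \<le> K * (r / t) powr \<alpha> * l ^ CARD('n)"
    if "l > 0" "t > 0" "r > 0" "cube_has_hole E a l t" for a l t r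
  proof -
    have "0 < r / t" using that by simp
    then obtain j where "\<mu> ^ j < r / t" using real_arch_pow_inv[of "r / t" \<mu>] \<mu> by auto
    then show ?thesis using bound[of j r t l a] that by simp
  qed
  moreover have "K > 0" using K by simp
  ultimately show ?thesis using that \<alpha>(1) by blast
qed

section \<open>Weak porosity gives a positive Muckenhoupt exponent\<close>

lemma abundant_holes_imp_max_hole_pos:
  fixes E :: "(real ^ 'n) set"
  assumes holes: "abundant_holes c \<kappa> E" and "c > 0" "R > 0"
  shows "max_hole E (ball x R) > 0"
proof -
  define s where "s = R / real CARD('n)"
  define a where "a = (\<chi> i. x $ i - s / 2)"
  have s: "s > 0" using \<open>R > 0\<close> by (simp add: s_def)
  have sub: "half_open_cube a s \<subseteq> ball x R"
    using cube_subset_ball[OF \<open>R > 0\<close>, of x] by (simp add: a_def s_def)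
  obtain F where F: "F \<subseteq> free_dyadic E (half_open_cube a s)"
    and tot: "c * s ^ CARD('n) \<le> (\<Sum>Q\<in>F. measure lebesgue Q)"
    by (rule abundant_holesE[OF holes s, of a]) (rule that)
  have "0 < c * s ^ CARD('n)" using \<open>c > 0\<close> s by simp
  then obtain Q where "Q \<in> F" using tot by fastforce
  then have "Q \<in> free_dyadic E (half_open_cube a s)" using F by blast
  from free_dyadicE[OF s this] obtain b u
    where u: "Q = half_open_cube b u" "u > 0" "Q \<subseteq> half_open_cube a s - E" .
  then have "half_open_cube b u \<subseteq> ball x R - E" using sub by blast
  from le_max_hole[OF _ ball_subset_centred_cube[OF this]] u(2) show ?thesis by simp
qed

text \<open>
  The ball lies in a cube of side \<open>2 * R\<close> and contains one of side \<open>R / n\<close>, and a hole of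
  radius \<open>h / 2\<close> in the ball contains a free cube of side \<open>h / (2 * n)\<close>. The supremum \<open>h\<close> need
  not be attained, hence the half.
\<close>

lemma abundant_holes_imp_Mu_exponent:
  fixes E :: "(real ^ 'n) set"
  assumes E: "E \<noteq> {}" and holes: "abundant_holes c \<kappa> E" and c: "0 < c" "c < 1" and \<kappa>: "0 < \<kappa>" "\<kappa> < 1"
  obtains \<alpha> where "\<alpha> > 0" "\<alpha> \<in> Mu_exponents E"
proof -
  let ?n = "real CARD('n)" and ?m = "measure lebesgue"
  obtain K \<alpha> where K: "K > 0" and \<alpha>: "\<alpha> > 0" and decay:
    "\<And>a l t r. \<lbrakk>l > 0; t > 0; r > 0; cube_has_hole E a l t\<rbrakk> \<Longrightarrow>
      ?m (neighbourhood E r \<inter> half_open_cube a l) \<le> K * (r / t) powr \<alpha> * l ^ CARD('n)"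
    using neighbourhood_decay_in_cubes[OF E holes c \<kappa>] by blast
  define C where "C = K * (2 * ?n) powr \<alpha> * (2 * ?n) ^ CARD('n)"
  have n: "?n \<ge> 1" by (simp add: Suc_leI)
  have "?m (neighbourhood E r \<inter> ball x R) / ?m (ball x R) \<le> C * (max_hole E (ball x R) / r) powr (- \<alpha>)"
    if r: "0 < r" "r < max_hole E (ball x R)" and R: "max_hole E (ball x R) \<le> R" for x r R
  proof -
    define h where "h = max_hole E (ball x R)"
    have h: "h > 0" "R > 0" using r R unfolding h_def by linarith+
    let ?P = "half_open_cube (\<chi> i. x $ i - R) (2 * R)"
    have BP: "ball x R \<subseteq> ?P" by (rule ball_subset_cube)
    have P: "?P \<in> lmeasurable" using h by (intro cube_measure(1)) simp
    have "cube_has_hole E (\<chi> i. x $ i - R) (2 * R) (h / 2 / ?n)"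
    proof -
      obtain y t where t: "h / 2 < t" "ball y t \<subseteq> ball x R - E"
      proof (rule less_max_holeE)
        show "0 \<le> h / 2" using h by simp
        show "h / 2 < max_hole E (ball x R)" using h unfolding h_def by simp
      qed (rule that)
      have "half_open_cube (\<chi> i. y $ i - h / 2 / ?n / 2) (h / 2 / ?n) \<subseteq> ball y (h / 2)"
        using h by (intro cube_subset_ball) simp
      also have "\<dots> \<subseteq> ball y t" using t by (intro subset_ball) simp
      also have "\<dots> \<subseteq> ?P - E" using t(2) BP by blast
      finally show ?thesis unfolding cube_has_hole_def by blast
    qed
    then have cube_bound: "?m (neighbourhood E r \<inter> ?P) \<le> K * (r / (h / 2 / ?n)) powr \<alpha> * (2 * R) ^ CARD('n)"
      using h r n by (intro decay) auto
    have ratio: "r / (h / 2 / ?n) = 2 * ?n * (r / h)" by simp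
    have "?m (neighbourhood E r \<inter> ball x R) \<le> ?m (neighbourhood E r \<inter> ?P)"
    proof (rule measure_mono_fmeasurable)
      show "neighbourhood E r \<inter> ?P \<in> lmeasurable"
        using P by (subst Int_commute) (auto intro: fmeasurable_Int_fmeasurable)
    qed (use BP in \<open>auto simp: borel_open\<close>)
    also note cube_bound
    also have "(r / (h / 2 / ?n)) powr \<alpha> = (2 * ?n) powr \<alpha> * (r / h) powr \<alpha>"
      unfolding ratio by (rule powr_mult)
    finally have upper: "?m (neighbourhood E r \<inter> ball x R)
        \<le> K * (2 * ?n) powr \<alpha> * (r / h) powr \<alpha> * (2 * R) ^ CARD('n)"
      by (simp only: mult.assoc)
    have lower: "(R / ?n) ^ CARD('n) \<le> ?m (ball x R)"
    proof -
      have "?m (half_open_cube (\<chi> i. x $ i - R / ?n / 2) (R / ?n)) \<le> ?m (ball x R)"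
        using h by (intro measure_mono_fmeasurable cube_subset_ball fmeasurableD[OF cube_measure(1)]) auto
      then show ?thesis using h by (simp add: cube_measure(2))
    qed
    have "2 * R = 2 * ?n * (R / ?n)" using n by simp
    then have "(2 * R) ^ CARD('n) = (2 * ?n) ^ CARD('n) * (R / ?n) ^ CARD('n)"
      by (simp only: power_mult_distrib)
    also have "\<dots> \<le> (2 * ?n) ^ CARD('n) * ?m (ball x R)" using lower by (intro mult_left_mono) auto
    finally have "K * (2 * ?n) powr \<alpha> * (r / h) powr \<alpha> * (2 * R) ^ CARD('n)
        \<le> K * (2 * ?n) powr \<alpha> * (r / h) powr \<alpha> * ((2 * ?n) ^ CARD('n) * ?m (ball x R))"
      using K by (intro mult_left_mono) auto
    also have "\<dots> = C * (r / h) powr \<alpha> * ?m (ball x R)" by (simp only: C_def mult_ac)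
    finally have "?m (neighbourhood E r \<inter> ball x R) \<le> C * (r / h) powr \<alpha> * ?m (ball x R)"
      using upper by simp
    moreover have "(r / h) powr \<alpha> = (h / r) powr (- \<alpha>)"
      using h r by (simp add: powr_minus_divide powr_divide)
    ultimately show ?thesis
      using content_ball_pos[OF h(2), of x] unfolding h_def[symmetric] by (simp add: divide_le_eq)
  qed
  then have "\<alpha> \<in> Mu_exponents E" unfolding Mu_exponents_def by blast
  with \<alpha> show ?thesis using that by blast
qed

theorem corollary6p6:
  fixes E :: "(real ^ 'n) set"
  assumes "E \<noteq> {}"
  shows "weakly_porous E \<longleftrightarrow> Mu E > 0"
proof
  assume "weakly_porous E"
  then obtain c \<kappa> where c: "0 < c" "c < 1" and \<kappa>: "0 < \<kappa>" "\<kappa> < 1" and holes: "abundant_holes c \<kappa> E"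
    by (rule weakly_porous_imp_abundant_holes)
  obtain \<alpha> where \<alpha>: "\<alpha> > 0" "\<alpha> \<in> Mu_exponents E"
    by (rule abundant_holes_imp_Mu_exponent[OF assms holes c \<kappa>])
  have "0 < ereal \<alpha>" using \<alpha> by simp
  also have "\<dots> \<le> Sup (ereal ` Mu_exponents E)" using \<alpha> by (intro Sup_upper) blast
  also have "\<dots> = Mu E"
    unfolding Mu_def using abundant_holes_imp_max_hole_pos[OF holes c(1)] by simp
  finally show "Mu E > 0" .
next
  assume Mu: "Mu E > 0"
  have all_pos: "\<forall>x\<in>E. \<forall>R>0. max_hole E (ball x R) > 0"
  proof (rule ccontr)
    assume "\<not> ?thesis"
    then have "Mu E = 0" unfolding Mu_def by (rule if_not_P)
    then show False using Mu by simp
  qed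
  then have pos: "max_hole E (ball x R) > 0" if "x \<in> E" "R > 0" for x R using that by blast
  have "Mu E = Sup (ereal ` Mu_exponents E)" unfolding Mu_def using all_pos by (rule if_P)
  then have "0 < Sup (ereal ` Mu_exponents E)" using Mu by simp
  then obtain \<alpha> where \<alpha>: "\<alpha> \<in> Mu_exponents E" "\<alpha> > 0"
    unfolding less_Sup_iff by auto
  obtain \<kappa> where "0 < \<kappa>" "\<kappa> < 1" "abundant_holes (1 / 2) \<kappa> E"
    by (rule Mu_exponent_imp_abundant_holes[OF assms \<alpha> pos])
  then show "weakly_porous E" by (intro abundant_holes_imp_weakly_porous[of "1 / 2" \<kappa>]) auto
qed

end
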